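(* Let $(M,\tilde\varphi,\xi,\eta,\tilde g)$ be a $3$-dimensional paracontact metric manifold. Then $\xi$ is a harmonic vector field if and only if $\xi$ is an eigenvector of the Ricci operator $\tilde Q$ of $(M,\tilde g)$ (that is, $\tilde Q\xi$ is at every point collinear to $\xi$).
   Context: A paracontact metric manifold $(M^{2n+1},\tilde\varphi,\xi,\eta,\tilde g)$ is a smooth manifold with a $(1,1)$-tensor field $\tilde\varphi$, a vector field $\xi$ (the characteristic vector field), a $1$-form $\eta$ and a pseudo-Riemannian metric $\tilde g$ such that: $\eta(\xi)=1$ and $\tilde\varphi^2=I-\eta\otimes\xi$; the $\pm1$-eigendistributions of $\tilde\varphi$ on $\ker\eta$ both have dimension $n$; $\tilde g(\tilde\varphi X,\tilde\varphi Y)=-\tilde g(X,Y)+\eta(X)\eta(Y)$; and $d\eta(X,Y)=\tilde g(X,\tilde\varphi Y)$, where $2d\eta(X,Y)=X\eta(Y)-Y\eta(X)-\eta([X,Y])$. The metric then has signature $(n+1,n)$ and $\tilde g(\xi,\xi)=1$. $\tilde\nabla$ is the Levi-Civita connection of $\tilde g$; $\tilde Q$ is the Ricci operator, $\tilde S(X,Y)=\tilde g(\tilde QX,Y)$ with $\tilde S$ the Ricci tensor. Harmonic vector field: a vector field $V$ of constant nonzero length is harmonic if it is a critical point of the energy functional restricted to vector fields of the same length; equivalently (this characterization may be taken as the definition), $\tilde\nabla^*\tilde\nabla V$ is collinear to $V$, where $\tilde\nabla^*\tilde\nabla V=\sum_i\varepsilon_i\big(\tilde\nabla_{e_i}\tilde\nabla_{e_i}V-\tilde\nabla_{\tilde\nabla_{e_i}e_i}V\big)$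 for any local pseudo-orthonormal frame $\{e_i\}$ with $\tilde g(e_i,e_j)=\varepsilon_i\delta_{ij}$, $\varepsilon_i=\pm1$. *)

theory Defs
  imports "HOL-Analysis.Analysis" "HOL-Library.Function_Algebras"
begin

text \<open>Tangent vectors are real-valued operators on functions, so that functions into a real
  vector space have to form a real vector space.\<close>

instantiation "fun" :: (type, scaleR) scaleR
begin

definition scaleR_fun :: "real \<Rightarrow> ('a \<Rightarrow> 'b) \<Rightarrow> 'a \<Rightarrow> 'b"
  where "scaleR_fun r f = (\<lambda>x. r *\<^sub>R f x)"

instance ..

end

instance "fun" :: (type, real_vector) real_vector
  by standard (simp_all add: scaleR_fun_def fun_eq_iff scaleR_add_right scaleR_add_left)

section \<open>Smooth manifolds\<close>

text \<open>These two notions are meant for open \<open>S\<close>; the derivative condition is imposed in all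
  directions, which in finite dimension gives the usual classes \<open>C\<^sup>k\<close> and \<open>C\<^sup>\<infinity>\<close>.\<close>

primrec Ck_on :: "nat \<Rightarrow> 'a::real_normed_vector set \<Rightarrow> ('a \<Rightarrow> 'b::real_normed_vector) \<Rightarrow> bool"
  where
    "Ck_on 0 S f \<longleftrightarrow> continuous_on S f"
  | "Ck_on (Suc k) S f \<longleftrightarrow>
       (\<forall>x\<in>S. f differentiable (at x)) \<and>
       (\<forall>v. Ck_on k S (\<lambda>x. frechet_derivative f (at x) v))"

definition smooth_on :: "'a::real_normed_vector set \<Rightarrow> ('a \<Rightarrow> 'b::real_normed_vector) \<Rightarrow> bool"
  where "smooth_on S f \<longleftrightarrow> (\<forall>k. Ck_on k S f)"

text \<open>A chart is a pair of its domain and its coordinate map.\<close>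

type_synonym ('m, 'd) chart = "'m set \<times> ('m \<Rightarrow> real ^ 'd)"

definition chart_inv :: "('m, 'd) chart \<Rightarrow> real ^ 'd \<Rightarrow> 'm"
  where "chart_inv c = inv_into (fst c) (snd c)"

definition is_chart :: "('m::topological_space, 'd::finite) chart \<Rightarrow> bool"
  where "is_chart c \<longleftrightarrow> open (fst c) \<and> open (snd c ` fst c) \<and>
           homeomorphism (fst c) (snd c ` fst c) (snd c) (chart_inv c)"

text \<open>The manifold is the whole type \<open>'m\<close>, which carries its topology; the atlas need not be
  maximal.\<close>

locale smooth_manifold =
  fixes A :: "('m::{t2_space, second_countable_topology}, 'd::finite) chart set"
  assumes charts: "c \<in> A \<Longrightarrow> is_chart c"
    and cover: "(\<Union>c\<in>A. fst c) = UNIV"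
    and compatible: "c \<in> A \<Longrightarrow> c' \<in> A \<Longrightarrow>
          smooth_on (snd c ` (fst c \<inter> fst c')) (snd c' \<circ> chart_inv c)"

definition smooth_fun_on ::
    "('m::topological_space, 'd::finite) chart set \<Rightarrow> 'm set \<Rightarrow> ('m \<Rightarrow> real) \<Rightarrow> bool"
  where "smooth_fun_on A U f \<longleftrightarrow>
           (\<forall>c\<in>A. smooth_on (snd c ` (U \<inter> fst c)) (f \<circ> chart_inv c))"

definition smooth_at ::
    "('m::topological_space, 'd::finite) chart set \<Rightarrow> 'm \<Rightarrow> ('m \<Rightarrow> real) \<Rightarrow> bool"
  where "smooth_at A p f \<longleftrightarrow> (\<exists>U. open U \<and> p \<in> U \<and> smooth_fun_on A U f)"

text \<open>A tangent vector at \<open>p\<close> is the directional derivative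
  \<open>f \<mapsto> \<Sum>\<^sub>i w\<^sub>i (\<partial>f/\<partial>x\<^sub>i)(p)\<close> acting on the functions that are smooth near \<open>p\<close>. It is set to
  \<open>0\<close> on all other functions, so that equality of tangent vectors is equality in HOL.\<close>

type_synonym 'm tvec = "('m \<Rightarrow> real) \<Rightarrow> real"

definition chart_tvec ::
    "('m::topological_space, 'd::finite) chart set \<Rightarrow> ('m, 'd) chart \<Rightarrow> 'm \<Rightarrow> real ^ 'd \<Rightarrow> 'm tvec"
  where "chart_tvec A c p w =
           (\<lambda>f. if smooth_at A p f
                then frechet_derivative (f \<circ> chart_inv c) (at (snd c p)) w else 0)"

definition tangent_space ::
    "('m::topological_space, 'd::finite) chart set \<Rightarrow> 'm \<Rightarrow> 'm tvec set"
  where "tangent_space A p = {chart_tvec A c p w | c w. c \<in> A \<and> p \<in> fst c}"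

text \<open>Vector fields on an open set \<open>U\<close> are total functions whose values outside \<open>U\<close> are
  irrelevant; likewise for the functions on \<open>U\<close>.\<close>

type_synonym 'm vfield = "'m \<Rightarrow> 'm tvec"

definition smooth_vfield_on ::
    "('m::topological_space, 'd::finite) chart set \<Rightarrow> 'm set \<Rightarrow> 'm vfield \<Rightarrow> bool"
  where "smooth_vfield_on A U X \<longleftrightarrow>
           (\<forall>p\<in>U. X p \<in> tangent_space A p) \<and>
           (\<forall>W f. open W \<and> W \<subseteq> U \<and> smooth_fun_on A W f \<longrightarrow> smooth_fun_on A W (\<lambda>p. X p f))"

definition lie_bracket ::
    "('m::topological_space, 'd::finite) chart set \<Rightarrow> 'm vfield \<Rightarrow> 'm vfield \<Rightarrow> 'm vfield"
  where "lie_bracket A X Y p =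
           (\<lambda>f. if smooth_at A p f then X p (\<lambda>q. Y q f) - Y p (\<lambda>q. X q f) else 0)"

section \<open>Tensor fields\<close>

definition linear_on ::
    "'a::real_vector set \<Rightarrow> ('a \<Rightarrow> 'b::real_vector) \<Rightarrow> bool"
  where "linear_on V L \<longleftrightarrow>
           (\<forall>u\<in>V. \<forall>v\<in>V. L (u + v) = L u + L v) \<and> (\<forall>r. \<forall>v\<in>V. L (r *\<^sub>R v) = r *\<^sub>R L v)"

definition one_form ::
    "('m::topological_space, 'd::finite) chart set \<Rightarrow> ('m \<Rightarrow> 'm tvec \<Rightarrow> real) \<Rightarrow> bool"
  where "one_form A \<eta> \<longleftrightarrow>
           (\<forall>p. linear_on (tangent_space A p) (\<eta> p)) \<and>
           (\<forall>U X. open U \<and> smooth_vfield_on A U X \<longrightarrow> smooth_fun_on A U (\<lambda>p. \<eta> p (X p)))"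

definition endomorphism_field ::
    "('m::topological_space, 'd::finite) chart set \<Rightarrow> ('m \<Rightarrow> 'm tvec \<Rightarrow> 'm tvec) \<Rightarrow> bool"
  where "endomorphism_field A \<phi> \<longleftrightarrow>
           (\<forall>p. \<phi> p ` tangent_space A p \<subseteq> tangent_space A p \<and>
                linear_on (tangent_space A p) (\<phi> p)) \<and>
           (\<forall>U X. open U \<and> smooth_vfield_on A U X \<longrightarrow> smooth_vfield_on A U (\<lambda>p. \<phi> p (X p)))"

text \<open>The convention is \<open>2 d\<eta>(X, Y) = X \<eta>(Y) - Y \<eta>(X) - \<eta>([X, Y])\<close>.\<close>

definition ext_deriv ::
    "('m::topological_space, 'd::finite) chart set \<Rightarrow> ('m \<Rightarrow> 'm tvec \<Rightarrow> real) \<Rightarrow>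
     'm vfield \<Rightarrow> 'm vfield \<Rightarrow> 'm \<Rightarrow> real"
  where "ext_deriv A \<eta> X Y p =
           (X p (\<lambda>q. \<eta> q (Y q)) - Y p (\<lambda>q. \<eta> q (X q)) - \<eta> p (lie_bracket A X Y p)) / 2"

locale pseudo_riemannian_manifold = smooth_manifold A
  for A :: "('m::{t2_space, second_countable_topology}, 'd::finite) chart set" +
  fixes g :: "'m \<Rightarrow> 'm tvec \<Rightarrow> 'm tvec \<Rightarrow> real"
  assumes metric_linear: "u \<in> tangent_space A p \<Longrightarrow> linear_on (tangent_space A p) (g p u)"
    and metric_sym: "u \<in> tangent_space A p \<Longrightarrow> v \<in> tangent_space A p \<Longrightarrow> g p u v = g p v u"
    and metric_nondegenerate:
      "u \<in> tangent_space A p \<Longrightarrow> (\<And>v. v \<in> tangent_space A p \<Longrightarrow> g p u v = 0) \<Longrightarrow> u = 0"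
    and metric_smooth:
      "open U \<Longrightarrow> smooth_vfield_on A U X \<Longrightarrow> smooth_vfield_on A U Y \<Longrightarrow>
         smooth_fun_on A U (\<lambda>p. g p (X p) (Y p))"

section \<open>Connection, curvature and rough Laplacian\<close>

text \<open>The connection acts on local vector fields. That \<open>nabla X Y\<close> at \<open>p\<close> depends only on the
  germs of \<open>X\<close> and \<open>Y\<close> at \<open>p\<close> follows from \<open>nabla_scale_left\<close> and \<open>nabla_leibniz\<close>, applied to
  functions \<open>f\<close> that are \<open>1\<close> on \<open>U\<close> and \<open>0\<close> outside \<open>U\<close>.\<close>

locale levi_civita_connection = pseudo_riemannian_manifold A g
  for A :: "('m::{t2_space, second_countable_topology}, 'd::finite) chart set" and g +
  fixes nabla :: "'m vfield \<Rightarrow> 'm vfield \<Rightarrow> 'm vfield"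
  assumes nabla_smooth:
      "open U \<Longrightarrow> smooth_vfield_on A U X \<Longrightarrow> smooth_vfield_on A U Y \<Longrightarrow>
         smooth_vfield_on A U (nabla X Y)"
    and nabla_add_left:
      "open U \<Longrightarrow> smooth_vfield_on A U X \<Longrightarrow> smooth_vfield_on A U X' \<Longrightarrow>
         smooth_vfield_on A U Y \<Longrightarrow> p \<in> U \<Longrightarrow>
         nabla (\<lambda>q. X q + X' q) Y p = nabla X Y p + nabla X' Y p"
    and nabla_scale_left:
      "open U \<Longrightarrow> smooth_fun_on A U f \<Longrightarrow> smooth_vfield_on A U X \<Longrightarrow>
         smooth_vfield_on A U Y \<Longrightarrow> p \<in> U \<Longrightarrow>
         nabla (\<lambda>q. f q *\<^sub>R X q) Y p = f p *\<^sub>R nabla X Y p"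
    and nabla_add_right:
      "open U \<Longrightarrow> smooth_vfield_on A U X \<Longrightarrow> smooth_vfield_on A U Y \<Longrightarrow>
         smooth_vfield_on A U Y' \<Longrightarrow> p \<in> U \<Longrightarrow>
         nabla X (\<lambda>q. Y q + Y' q) p = nabla X Y p + nabla X Y' p"
    and nabla_leibniz:
      "open U \<Longrightarrow> smooth_fun_on A U f \<Longrightarrow> smooth_vfield_on A U X \<Longrightarrow>
         smooth_vfield_on A U Y \<Longrightarrow> p \<in> U \<Longrightarrow>
         nabla X (\<lambda>q. f q *\<^sub>R Y q) p = X p f *\<^sub>R Y p + f p *\<^sub>R nabla X Y p"
    and nabla_torsion_free:
      "open U \<Longrightarrow> smooth_vfield_on A U X \<Longrightarrow> smooth_vfield_on A U Y \<Longrightarrow> p \<in> U \<Longrightarrow>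
         nabla X Y p - nabla Y X p = lie_bracket A X Y p"
    and nabla_metric:
      "open U \<Longrightarrow> smooth_vfield_on A U X \<Longrightarrow> smooth_vfield_on A U Y \<Longrightarrow>
         smooth_vfield_on A U Z \<Longrightarrow> p \<in> U \<Longrightarrow>
         X p (\<lambda>q. g q (Y q) (Z q)) = g p (nabla X Y p) (Z p) + g p (Y p) (nabla X Z p)"

definition curvature ::
    "('m::topological_space, 'd::finite) chart set \<Rightarrow> ('m vfield \<Rightarrow> 'm vfield \<Rightarrow> 'm vfield) \<Rightarrow>
     'm vfield \<Rightarrow> 'm vfield \<Rightarrow> 'm vfield \<Rightarrow> 'm vfield"
  where "curvature A nabla X Y Z p =
           nabla X (nabla Y Z) p - nabla Y (nabla X Z) p - nabla (lie_bracket A X Y) Z p"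

text \<open>Since \<open>curvature\<close> is tensorial, its value at \<open>p\<close> is the same for all local vector fields
  extending the given tangent vectors at \<open>p\<close>.\<close>

definition curvature_at ::
    "('m::topological_space, 'd::finite) chart set \<Rightarrow> ('m vfield \<Rightarrow> 'm vfield \<Rightarrow> 'm vfield) \<Rightarrow>
     'm \<Rightarrow> 'm tvec \<Rightarrow> 'm tvec \<Rightarrow> 'm tvec \<Rightarrow> 'm tvec"
  where "curvature_at A nabla p u v w =
           (THE r. \<exists>U X Y Z. open U \<and> p \<in> U \<and>
              smooth_vfield_on A U X \<and> smooth_vfield_on A U Y \<and> smooth_vfield_on A U Z \<and>
              X p = u \<and> Y p = v \<and> Z p = w \<and> r = curvature A nabla X Y Z p)"

definition trace_on :: "'a::real_vector set \<Rightarrow> ('a \<Rightarrow> 'a) \<Rightarrow> real"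
  where "trace_on V L =
           (let B = (SOME B. independent B \<and> span B = V) in \<Sum>b\<in>B. representation B (L b) b)"

definition ricci_tensor ::
    "('m::topological_space, 'd::finite) chart set \<Rightarrow> ('m vfield \<Rightarrow> 'm vfield \<Rightarrow> 'm vfield) \<Rightarrow>
     'm \<Rightarrow> 'm tvec \<Rightarrow> 'm tvec \<Rightarrow> real"
  where "ricci_tensor A nabla p u v =
           trace_on (tangent_space A p) (\<lambda>w. curvature_at A nabla p w u v)"

definition ricci_operator ::
    "('m::topological_space, 'd::finite) chart set \<Rightarrow> ('m \<Rightarrow> 'm tvec \<Rightarrow> 'm tvec \<Rightarrow> real) \<Rightarrow>
     ('m vfield \<Rightarrow> 'm vfield \<Rightarrow> 'm vfield) \<Rightarrow> 'm \<Rightarrow> 'm tvec \<Rightarrow> 'm tvec"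
  where "ricci_operator A g nabla p u =
           (THE q. q \<in> tangent_space A p \<and>
              (\<forall>v\<in>tangent_space A p. g p q v = ricci_tensor A nabla p u v))"

definition pseudo_orthonormal_frame_on ::
    "('m::topological_space, 'd::finite) chart set \<Rightarrow> ('m \<Rightarrow> 'm tvec \<Rightarrow> 'm tvec \<Rightarrow> real) \<Rightarrow>
     'm set \<Rightarrow> ('d \<Rightarrow> 'm vfield) \<Rightarrow> ('d \<Rightarrow> real) \<Rightarrow> bool"
  where "pseudo_orthonormal_frame_on A g U e \<epsilon> \<longleftrightarrow>
           (\<forall>i. smooth_vfield_on A U (e i)) \<and> (\<forall>i. \<epsilon> i \<in> {1, -1}) \<and>
           (\<forall>p\<in>U. \<forall>i j. g p (e i p) (e j p) = (if i = j then \<epsilon> i else 0))"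

text \<open>The sum does not depend on the local frame used to compute it. No minus sign is put in
  front of it.\<close>

definition rough_laplacian ::
    "('m::topological_space, 'd::finite) chart set \<Rightarrow> ('m \<Rightarrow> 'm tvec \<Rightarrow> 'm tvec \<Rightarrow> real) \<Rightarrow>
     ('m vfield \<Rightarrow> 'm vfield \<Rightarrow> 'm vfield) \<Rightarrow> 'm vfield \<Rightarrow> 'm vfield"
  where "rough_laplacian A g nabla V p =
           (THE w. \<exists>U e \<epsilon>. open U \<and> p \<in> U \<and> pseudo_orthonormal_frame_on A g U e \<epsilon> \<and>
              w = (\<Sum>i\<in>UNIV. \<epsilon> i *\<^sub>R (nabla (e i) (nabla (e i) V) p - nabla (nabla (e i) (e i)) V p)))"

definition harmonic_vector_field ::
    "('m::topological_space, 'd::finite) chart set \<Rightarrow> ('m \<Rightarrow> 'm tvec \<Rightarrow> 'm tvec \<Rightarrow> real) \<Rightarrow>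
     ('m vfield \<Rightarrow> 'm vfield \<Rightarrow> 'm vfield) \<Rightarrow> 'm vfield \<Rightarrow> bool"
  where "harmonic_vector_field A g nabla V \<longleftrightarrow>
           smooth_vfield_on A UNIV V \<and>
           (\<exists>c. c \<noteq> 0 \<and> (\<forall>p. g p (V p) (V p) = c)) \<and>
           (\<forall>p. \<exists>c. rough_laplacian A g nabla V p = c *\<^sub>R V p)"

section \<open>Paracontact metric manifolds\<close>

text \<open>The eigendistributions of \<open>\<phi>\<close> on \<open>ker \<eta>\<close> have dimension \<open>n\<close>, where
  \<open>CARD('d) = 2 n + 1\<close> is the dimension of the manifold.\<close>

locale paracontact_metric_manifold = pseudo_riemannian_manifold A g
  for A :: "('m::{t2_space, second_countable_topology}, 'd::finite) chart set"
    and \<phi> :: "'m \<Rightarrow> 'm tvec \<Rightarrow> 'm tvec"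
    and \<xi> :: "'m vfield"
    and \<eta> :: "'m \<Rightarrow> 'm tvec \<Rightarrow> real"
    and g +
  assumes phi_tensor: "endomorphism_field A \<phi>"
    and xi_vfield: "smooth_vfield_on A UNIV \<xi>"
    and eta_form: "one_form A \<eta>"
    and eta_xi: "\<eta> p (\<xi> p) = 1"
    and phi_square: "v \<in> tangent_space A p \<Longrightarrow> \<phi> p (\<phi> p v) = v - \<eta> p v *\<^sub>R \<xi> p"
    and dim_plus:
      "2 * dim {v \<in> tangent_space A p. \<eta> p v = 0 \<and> \<phi> p v = v} + 1 = CARD('d)"
    and dim_minus:
      "2 * dim {v \<in> tangent_space A p. \<eta> p v = 0 \<and> \<phi> p v = - v} + 1 = CARD('d)"
    and metric_phi:
      "u \<in> tangent_space A p \<Longrightarrow> v \<in> tangent_space A p \<Longrightarrow>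
         g p (\<phi> p u) (\<phi> p v) = - g p u v + \<eta> p u * \<eta> p v"
    and deta:
      "open U \<Longrightarrow> smooth_vfield_on A U X \<Longrightarrow> smooth_vfield_on A U Y \<Longrightarrow> p \<in> U \<Longrightarrow>
         ext_deriv A \<eta> X Y p = g p (X p) (\<phi> p (Y p))"

end

theory Submission
  imports Defs
begin

text \<open>Near any point there is an adapted frame \<open>e\<^sub>1 = \<xi>\<close>, \<open>e\<^sub>2\<close>, \<open>e\<^sub>3\<close> with \<open>\<phi> e\<^sub>3 = e\<^sub>2\<close> and signs
  \<open>1, 1, -1\<close>. Put \<open>\<omega>\<^sub>i\<^sub>j\<^sub>k = g(\<nabla>\<^sub>e\<^sub>i e\<^sub>j, e\<^sub>k)\<close>. The formula for \<open>d\<eta>\<close> gives \<open>\<omega>\<^sub>1\<^sub>1\<^sub>k = 0\<close> and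
  \<open>\<omega>\<^sub>2\<^sub>1\<^sub>3 - \<omega>\<^sub>3\<^sub>1\<^sub>2 = 2\<close>, and the \<open>\<xi>\<close>-component of the Jacobi identity for the frame (that is,
  \<open>d(d\<eta>) = 0\<close>) gives \<open>\<omega>\<^sub>2\<^sub>1\<^sub>2 = \<omega>\<^sub>3\<^sub>1\<^sub>3\<close>. Substituting these into the frame expressions, the
  components along \<open>e\<^sub>2\<close> and \<open>e\<^sub>3\<close> of \<open>\<nabla>\<^sup>*\<nabla>\<xi>\<close> and of \<open>Q\<xi>\<close> agree up to the remaining components of
  the Jacobi identity. Hence \<open>\<nabla>\<^sup>*\<nabla>\<xi>\<close> and \<open>Q\<xi>\<close> differ by a multiple of \<open>\<xi>\<close>.\<close>

section \<open>Differentiable functions\<close>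

text \<open>There is an invariant reason behind the frame computation. The formula for d\<eta> reads
  g(\<nabla>_Z \<xi>, W) - g(\<nabla>_W \<xi>, Z) = 2 g(Z, \<phi> W). Differentiating it along W and
  tracing over W gives Ric(Z, \<xi>) + Z(div \<xi>) = g(L \<xi>, Z) + 2 g(Z, div \<phi>), where L is
  the rough Laplacian. In dimension 3 the form d\<eta> is a constant multiple of the Hodge dual of
  \<eta>. So closedness of d\<eta> means div \<xi> = 0, and the codifferential of d\<eta> is a
  multiple of \<eta>, which makes div \<phi> collinear to \<xi>.

  The length of the proof has another source: curvature, Ricci operator and rough Laplacian are
  definite descriptions, ranging over local fields or frames that are total functions with arbitrary
  values outside their domain. Each description has to be evaluated in one frame, by tensoriality
  and by passing to intersections of domains, before components can be compared.\<close>

lemma frechet_derivative_cong_open: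
  assumes "open S" "x \<in> S" "\<And>y. y \<in> S \<Longrightarrow> f y = g y"
  shows "f differentiable (at x) \<longleftrightarrow> g differentiable (at x)"
    and "frechet_derivative f (at x) = frechet_derivative g (at x)"
proof -
  \<comment> \<open>\<open>frechet_derivative\<close> is a choice among the derivatives, so the
    equivalence for all \<open>D\<close> also covers points where no derivative exists.\<close>
  have "(f has_derivative D) (at x) \<longleftrightarrow> (g has_derivative D) (at x)" for D
    using has_derivative_transform_within_open[OF _ assms(1,2)] assms(3) by metis
  then show "f differentiable (at x) \<longleftrightarrow> g differentiable (at x)"
    and "frechet_derivative f (at x) = frechet_derivative g (at x)"
    by (simp_all add: differentiable_def frechet_derivative_def)
qed

lemma Ck_on_cong:
  assumes "open S" "\<And>x. x \<in> S \<Longrightarrow> f x = g x"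
  shows "Ck_on k S f \<longleftrightarrow> Ck_on k S g"
  using assms(2)
proof (induction k arbitrary: f g)
  case 0
  then show ?case by (simp cong: continuous_on_cong)
next
  case (Suc k)
  have "Ck_on k S (\<lambda>x. frechet_derivative f (at x) v) \<longleftrightarrow>
      Ck_on k S (\<lambda>x. frechet_derivative g (at x) v)" for v
    using frechet_derivative_cong_open(2)[OF assms(1), of _ f g] Suc.prems by (intro Suc.IH) simp
  then show ?case
    using frechet_derivative_cong_open(1)[OF assms(1), of _ f g] Suc.prems by auto
qed

lemma Ck_on_subset: "Ck_on k S f \<Longrightarrow> T \<subseteq> S \<Longrightarrow> Ck_on k T f"
  by (induction k arbitrary: f) (auto intro: continuous_on_subset)

lemma Ck_on_imp_continuous_on: "Ck_on k S f \<Longrightarrow> continuous_on S f"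
  by (cases k) (auto intro: differentiable_imp_continuous_on
      simp: differentiable_on_def differentiable_at_withinI)

lemma Ck_on_SucD: "Ck_on (Suc k) S f \<Longrightarrow> Ck_on k S f"
proof (induction k arbitrary: f)
  case 0
  then show ?case using Ck_on_imp_continuous_on by fastforce
next
  case (Suc k)
  then show ?case by simp
qed

lemma Ck_on_const [simp]: "Ck_on k S (\<lambda>x. c)"
  by (induction k arbitrary: c) (auto)

lemma Ck_on_linear:
  assumes "bounded_linear h" "open S" "Ck_on k S f"
  shows "Ck_on k S (\<lambda>x. h (f x))"
  using assms(3)
proof (induction k arbitrary: f)
  case 0
  then show ?case
    using bounded_linear.continuous_on[OF assms(1)] by auto
next
  case (Suc k)
  have D: "((\<lambda>x. h (f x)) has_derivative (\<lambda>v. h (frechet_derivative f (at x) v))) (at x)"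
    if "x \<in> S" for x
    using Suc.prems that
    by (intro bounded_linear.has_derivative[OF assms(1)]) (auto simp: frechet_derivative_works[THEN iffD1])
  have "Ck_on k S (\<lambda>x. frechet_derivative (\<lambda>x. h (f x)) (at x) v)" for v
  proof (subst Ck_on_cong[OF assms(2)])
    show "frechet_derivative (\<lambda>x. h (f x)) (at x) v = h (frechet_derivative f (at x) v)"
      if "x \<in> S" for x
      using frechet_derivative_at[OF D[OF that]] by metis
    show "Ck_on k S (\<lambda>x. h (frechet_derivative f (at x) v))"
      using Suc by simp
  qed
  then show ?case using D by (auto simp: differentiable_def)
qed

lemma Ck_on_add:
  assumes "open S" "Ck_on k S f" "Ck_on k S g"
  shows "Ck_on k S (\<lambda>x. f x + g x)"
  using assms(2,3)
proof (induction k arbitrary: f g)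
  case 0
  then show ?case by (auto intro: continuous_on_add)
next
  case (Suc k)
  have D: "((\<lambda>x. f x + g x) has_derivative
      (\<lambda>v. frechet_derivative f (at x) v + frechet_derivative g (at x) v)) (at x)"
    if "x \<in> S" for x
    using Suc.prems that by (intro has_derivative_add) (auto simp: frechet_derivative_works[THEN iffD1])
  have "Ck_on k S (\<lambda>x. frechet_derivative (\<lambda>x. f x + g x) (at x) v)" for v
  proof (subst Ck_on_cong[OF assms(1)])
    show "frechet_derivative (\<lambda>x. f x + g x) (at x) v =
        frechet_derivative f (at x) v + frechet_derivative g (at x) v" if "x \<in> S" for x
      using frechet_derivative_at[OF D[OF that]] by metis
    show "Ck_on k S (\<lambda>x. frechet_derivative f (at x) v + frechet_derivative g (at x) v)"
      using Suc by simp
  qed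
  then show ?case using D by (auto simp: differentiable_def)
qed

lemma Ck_on_mult:
  fixes f g :: "'a::real_normed_vector \<Rightarrow> real"
  assumes "open S" "Ck_on k S f" "Ck_on k S g"
  shows "Ck_on k S (\<lambda>x. f x * g x)"
  using assms(2,3)
proof (induction k arbitrary: f g)
  case 0
  then show ?case by (auto intro: continuous_on_mult)
next
  case (Suc k)
  have D: "((\<lambda>x. f x * g x) has_derivative
      (\<lambda>v. f x * frechet_derivative g (at x) v + frechet_derivative f (at x) v * g x)) (at x)"
    if "x \<in> S" for x
    using Suc.prems that by (intro has_derivative_mult) (auto simp: frechet_derivative_works[THEN iffD1])
  have "Ck_on k S (\<lambda>x. frechet_derivative (\<lambda>x. f x * g x) (at x) v)" for v
  proof (subst Ck_on_cong[OF assms(1)])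
    show "frechet_derivative (\<lambda>x. f x * g x) (at x) v =
        f x * frechet_derivative g (at x) v + frechet_derivative f (at x) v * g x" if "x \<in> S" for x
      using frechet_derivative_at[OF D[OF that]] by metis
    have "Ck_on k S f" "Ck_on k S g"
      using Suc.prems by (auto intro: Ck_on_SucD simp del: Ck_on.simps)
    then show "Ck_on k S
        (\<lambda>x. f x * frechet_derivative g (at x) v + frechet_derivative f (at x) v * g x)"
      using Suc by (intro Ck_on_add[OF assms(1)]) auto
  qed
  then show ?case using D by (auto simp: differentiable_def)
qed

lemma Ck_on_sum:
  assumes "open S" "\<And>i. i \<in> I \<Longrightarrow> Ck_on k S (f i)"
  shows "Ck_on k S (\<lambda>x. \<Sum>i\<in>I. f i x)"
proof (cases "finite I")
  case True
  then show ?thesis using assms(2)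
    by (induction I rule: finite_induct) (auto intro: Ck_on_add[OF assms(1)])
qed simp

text \<open>The exponent is generalized in the induction because differentiation lowers it by one.
  With exponent -1/2 this gives the normalization of a vector field.\<close>

lemma Ck_on_powr:
  fixes f :: "'a::real_normed_vector \<Rightarrow> real"
  assumes "open S" "Ck_on k S f" "\<And>x. x \<in> S \<Longrightarrow> f x > 0"
  shows "Ck_on k S (\<lambda>x. f x powr a)"
  using assms(2)
proof (induction k arbitrary: a)
  case 0
  then show ?case
    using assms(3) by (auto intro!: continuous_on_powr simp: less_le)
next
  case (Suc k)
  have D: "((\<lambda>x. f x powr a) has_derivative
      (\<lambda>v. (a * f x powr (a - 1)) * frechet_derivative f (at x) v)) (at x)" if "x \<in> S" for x
  proof -
    have "((\<lambda>y. y powr a) has_derivative (\<lambda>v. (a * f x powr (a - 1)) * v)) (at (f x))"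
      using has_real_derivative_powr[OF assms(3)[OF that], of a]
      by (simp add: has_field_derivative_def)
    moreover have "(f has_derivative frechet_derivative f (at x)) (at x)"
      using Suc.prems that by (auto simp: frechet_derivative_works[THEN iffD1])
    ultimately show ?thesis
      using has_derivative_compose[of f _ x UNIV "\<lambda>y. y powr a"] by simp
  qed
  have "Ck_on k S (\<lambda>x. frechet_derivative (\<lambda>x. f x powr a) (at x) v)" for v
  proof (subst Ck_on_cong[OF assms(1)])
    show "frechet_derivative (\<lambda>x. f x powr a) (at x) v =
        (a * f x powr (a - 1)) * frechet_derivative f (at x) v" if "x \<in> S" for x
      using frechet_derivative_at[OF D[OF that]] by metis
    have "Ck_on k S f" using Suc.prems by (rule Ck_on_SucD)
    then show "Ck_on k S (\<lambda>x. (a * f x powr (a - 1)) * frechet_derivative f (at x) v)"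
      using Suc by (intro Ck_on_mult[OF assms(1)]) auto
  qed
  then show ?case using D by (auto simp: differentiable_def)
qed

text \<open>The chain rule differentiates \<open>f\<close> in the direction \<open>?u' x v\<close>,
  which varies with \<open>x\<close>, whereas \<open>Ck_on\<close> speaks of fixed directions.
  Expanding this direction in a basis leaves a sum of products, to which the induction hypothesis
  and the product rule apply.\<close>

lemma Ck_on_compose:
  fixes f :: "'b::euclidean_space \<Rightarrow> real" and u :: "'a::real_normed_vector \<Rightarrow> 'b"
  assumes "open S" "open T" "u ` S \<subseteq> T" "Ck_on k T f" "Ck_on k S u"
  shows "Ck_on k S (\<lambda>x. f (u x))"
  using assms(4,5)
proof (induction k arbitrary: f)
  case 0
  then show ?case using assms(3) by (auto intro: continuous_on_compose2)
next
  case (Suc k)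
  let ?f' = "\<lambda>x. frechet_derivative f (at x)" and ?u' = "\<lambda>x. frechet_derivative u (at x)"
  have df: "(f has_derivative ?f' (u x)) (at (u x))" if "x \<in> S" for x
    using Suc.prems that assms(3) by (auto simp: frechet_derivative_works[THEN iffD1])
  have D: "((\<lambda>x. f (u x)) has_derivative (\<lambda>v. ?f' (u x) (?u' x v))) (at x)" if "x \<in> S" for x
    using Suc.prems that
    by (intro has_derivative_compose[where f = u and g = f, OF _ df[OF that]])
      (auto simp: frechet_derivative_works[THEN iffD1])
  have "Ck_on k S (\<lambda>x. frechet_derivative (\<lambda>x. f (u x)) (at x) v)" for v
  proof (subst Ck_on_cong[OF assms(1)])
    show "frechet_derivative (\<lambda>x. f (u x)) (at x) v =
        (\<Sum>b\<in>Basis. (?u' x v \<bullet> b) * ?f' (u x) b)" if "x \<in> S" for x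
    proof -
      have "linear (?f' (u x))"
        using df[OF that] has_derivative_linear by blast
      then have "?f' (u x) (\<Sum>b\<in>Basis. (?u' x v \<bullet> b) *\<^sub>R b) =
          (\<Sum>b\<in>Basis. (?u' x v \<bullet> b) * ?f' (u x) b)"
        by (simp add: linear_sum linear_scale)
      then have "?f' (u x) (?u' x v) = (\<Sum>b\<in>Basis. (?u' x v \<bullet> b) * ?f' (u x) b)"
        unfolding euclidean_representation .
      then show ?thesis
        unfolding frechet_derivative_at[OF D[OF that], symmetric] .
    qed
    have u: "Ck_on k S u" using Suc.prems(2) by (rule Ck_on_SucD)
    show "Ck_on k S (\<lambda>x. \<Sum>b\<in>Basis. (?u' x v \<bullet> b) * ?f' (u x) b)"
    proof (intro Ck_on_sum Ck_on_mult assms(1))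
      show "Ck_on k S (\<lambda>x. ?u' x v \<bullet> b)" for b
        using Suc.prems by (intro Ck_on_linear[OF bounded_linear_inner_left assms(1)]) auto
      show "Ck_on k S (\<lambda>x. ?f' (u x) b)" for b
        using Suc.IH[OF _ u, of "\<lambda>y. ?f' y b"] Suc.prems by auto
    qed
  qed
  then show ?case using D by (auto simp: differentiable_def)
qed

section \<open>Tangent vectors and vector fields\<close>

lemma smooth_on_cong:
  "open S \<Longrightarrow> (\<And>x. x \<in> S \<Longrightarrow> f x = g x) \<Longrightarrow> smooth_on S f \<longleftrightarrow> smooth_on S g"
  unfolding smooth_on_def using Ck_on_cong by blast

lemma smooth_on_subset: "smooth_on S f \<Longrightarrow> T \<subseteq> S \<Longrightarrow> smooth_on T f"
  unfolding smooth_on_def using Ck_on_subset by blast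

lemma smooth_on_imp_differentiable: "smooth_on S f \<Longrightarrow> x \<in> S \<Longrightarrow> f differentiable (at x)"
  unfolding smooth_on_def by (meson Ck_on.simps(2))

lemma smooth_on_frechet_derivative:
  assumes "smooth_on S f"
  shows "smooth_on S (\<lambda>x. frechet_derivative f (at x) v)"
  unfolding smooth_on_def
proof
  fix k
  have "Ck_on (Suc k) S f" using assms unfolding smooth_on_def by blast
  then show "Ck_on k S (\<lambda>x. frechet_derivative f (at x) v)" by simp
qed

lemma smooth_on_imp_continuous_on: "smooth_on S f \<Longrightarrow> continuous_on S f"
  unfolding smooth_on_def using Ck_on_imp_continuous_on by blast

lemma smooth_on_compose:
  fixes f :: "'b::euclidean_space \<Rightarrow> real" and u :: "'a::real_normed_vector \<Rightarrow> 'b"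
  assumes "open S" "open T" "u ` S \<subseteq> T" "smooth_on T f" "smooth_on S u"
  shows "smooth_on S (f \<circ> u)"
  using assms unfolding smooth_on_def comp_def by (blast intro: Ck_on_compose)

context smooth_manifold
begin

section \<open>Charts and smooth functions\<close>

lemma chart_inv_chart [simp]: "c \<in> A \<Longrightarrow> q \<in> fst c \<Longrightarrow> chart_inv c (snd c q) = q"
  using charts unfolding is_chart_def homeomorphism_def by blast

lemma open_chart_domain: "c \<in> A \<Longrightarrow> open (fst c)"
  using charts unfolding is_chart_def by blast

lemma open_chart_image:
  assumes "c \<in> A" "open W"
  shows "open (snd c ` (W \<inter> fst c))"
proof -
  have h: "homeomorphism (fst c) (snd c ` fst c) (snd c) (chart_inv c)"
    and o: "open (snd c ` fst c)" "open (fst c)"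
    using charts[OF assms(1)] by (auto simp: is_chart_def)
  have "openin (top_of_set (fst c)) (W \<inter> fst c)"
    using assms(2) by (metis Int_commute openin_open_Int)
  then show ?thesis
    using homeomorphism_imp_open_map[OF h] o(1) openin_open_trans by blast
qed

lemma chart_exists: obtains c where "c \<in> A" "p \<in> fst c"
  using cover by blast

lemma smooth_fun_on_cong:
  assumes "open U" "\<And>q. q \<in> U \<Longrightarrow> f q = h q"
  shows "smooth_fun_on A U f \<longleftrightarrow> smooth_fun_on A U h"
  unfolding smooth_fun_on_def
proof (intro ball_cong refl smooth_on_cong)
  fix c x assume c: "c \<in> A"
  show "open (snd c ` (U \<inter> fst c))" by (rule open_chart_image[OF c assms(1)])
  show "(f \<circ> chart_inv c) x = (h \<circ> chart_inv c) x" if "x \<in> snd c ` (U \<inter> fst c)"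
    using that c assms(2) by (elim imageE) simp
qed

lemma smooth_fun_on_subset: "smooth_fun_on A U f \<Longrightarrow> W \<subseteq> U \<Longrightarrow> smooth_fun_on A W f"
  unfolding smooth_fun_on_def by (blast intro: smooth_on_subset)

lemma smooth_fun_on_const [simp]: "smooth_fun_on A U (\<lambda>q. r)"
  unfolding smooth_fun_on_def smooth_on_def comp_def by simp

lemma smooth_fun_on_add:
  "open U \<Longrightarrow> smooth_fun_on A U f \<Longrightarrow> smooth_fun_on A U h \<Longrightarrow> smooth_fun_on A U (\<lambda>q. f q + h q)"
  unfolding smooth_fun_on_def smooth_on_def comp_def
  by (simp add: Ck_on_add open_chart_image)

lemma smooth_fun_on_mult:
  "open U \<Longrightarrow> smooth_fun_on A U f \<Longrightarrow> smooth_fun_on A U h \<Longrightarrow> smooth_fun_on A U (\<lambda>q. f q * h q)"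
  unfolding smooth_fun_on_def smooth_on_def comp_def
  by (simp add: Ck_on_mult open_chart_image)

lemma smooth_fun_on_powr:
  assumes "open U" "smooth_fun_on A U f" "\<And>q. q \<in> U \<Longrightarrow> f q > 0"
  shows "smooth_fun_on A U (\<lambda>q. f q powr r)"
  unfolding smooth_fun_on_def smooth_on_def comp_def
proof (intro ballI allI Ck_on_powr)
  fix c k x assume c: "c \<in> A"
  show "open (snd c ` (U \<inter> fst c))" by (rule open_chart_image[OF c assms(1)])
  show "Ck_on k (snd c ` (U \<inter> fst c)) (\<lambda>x. f (chart_inv c x))"
    using assms(2) c unfolding smooth_fun_on_def smooth_on_def comp_def by blast
  show "0 < f (chart_inv c x)" if "x \<in> snd c ` (U \<inter> fst c)"
    using that c assms(3) by (elim imageE) simp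
qed

text \<open>Composition with the smooth transition map carries smoothness from one chart to all the
  others, so a single chart is enough.\<close>

lemma smooth_fun_on_chartI:
  assumes c: "c \<in> A" and W: "open W" "W \<subseteq> fst c"
    and f: "smooth_on (snd c ` W) (f \<circ> chart_inv c)"
  shows "smooth_fun_on A W f"
  unfolding smooth_fun_on_def
proof
  fix c' assume c': "c' \<in> A"
  let ?S = "snd c' ` (W \<inter> fst c')" and ?\<tau> = "snd c \<circ> chart_inv c'"
  have S: "open ?S" by (rule open_chart_image[OF c' W(1)])
  have "smooth_on ?S ((f \<circ> chart_inv c) \<circ> ?\<tau>)"
  proof (rule smooth_on_compose[OF S _ _ f])
    show "open (snd c ` W)"
      using open_chart_image[OF c W(1)] W(2) by (simp add: Int_absorb2)
    show "?\<tau> ` ?S \<subseteq> snd c ` W" using c' by auto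
    show "smooth_on ?S ?\<tau>"
      using W(2) by (auto intro: smooth_on_subset[OF compatible[OF c' c]])
  qed
  then show "smooth_on ?S (f \<circ> chart_inv c')"
    by (rule smooth_on_cong[OF S, THEN iffD1, rotated]) (use c c' W(2) in auto)
qed

text \<open>Serves to find an open set on which the length of a field stays positive.\<close>

lemma smooth_fun_on_imp_continuous_on:
  assumes "open U" "smooth_fun_on A U f"
  shows "continuous_on U f"
proof -
  have "continuous (at q) f" if "q \<in> U" for q
  proof -
    obtain c where c: "c \<in> A" "q \<in> fst c" by (rule chart_exists)
    have "continuous_on (snd c ` (U \<inter> fst c)) (f \<circ> chart_inv c)"
      using assms(2) c(1) unfolding smooth_fun_on_def by (blast intro: smooth_on_imp_continuous_on)
    moreover have "continuous_on (U \<inter> fst c) (snd c)"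
      using charts[OF c(1)] unfolding is_chart_def homeomorphism_def
      by (auto intro: continuous_on_subset)
    ultimately have "continuous_on (U \<inter> fst c) ((f \<circ> chart_inv c) \<circ> snd c)"
      by (rule continuous_on_compose[rotated])
    then have "continuous_on (U \<inter> fst c) f"
      by (rule continuous_on_cong[THEN iffD1, rotated 2]) (use c in auto)
    then show ?thesis
      using that c assms(1) open_chart_domain
      by (simp add: continuous_on_eq_continuous_at open_Int)
  qed
  then show ?thesis by (simp add: continuous_at_imp_continuous_on)
qed

section \<open>Functions smooth near a point and tangent vectors\<close>

lemma smooth_atI: "open U \<Longrightarrow> p \<in> U \<Longrightarrow> smooth_fun_on A U f \<Longrightarrow> smooth_at A p f"
  unfolding smooth_at_def by blast

lemma smooth_at_cong:
  assumes "open U" "p \<in> U" "\<And>q. q \<in> U \<Longrightarrow> f q = h q"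
  shows "smooth_at A p f \<longleftrightarrow> smooth_at A p h"
proof -
  have "smooth_at A p h'" if f': "smooth_at A p f'" and eq: "\<And>q. q \<in> U \<Longrightarrow> f' q = h' q" for f' h'
  proof -
    obtain W where W: "open W" "p \<in> W" "smooth_fun_on A W f'"
      using f' unfolding smooth_at_def by blast
    have "smooth_fun_on A (U \<inter> W) f'" using smooth_fun_on_subset[OF W(3)] by simp
    then have "smooth_fun_on A (U \<inter> W) h'"
      by (rule smooth_fun_on_cong[THEN iffD1, rotated 2])
        (use eq assms(1) W(1) in \<open>simp_all add: open_Int\<close>)
    then show ?thesis using assms(1,2) W by (intro smooth_atI[of "U \<inter> W"]) auto
  qed
  from this[of f h] this[of h f] show ?thesis using assms(3) by auto
qed

lemma smooth_at_add:
  assumes "smooth_at A p f" "smooth_at A p h"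
  shows "smooth_at A p (\<lambda>q. f q + h q)"
proof -
  obtain U W where U: "open U" "p \<in> U" "smooth_fun_on A U f"
    and W: "open W" "p \<in> W" "smooth_fun_on A W h"
    using assms unfolding smooth_at_def by blast
  have "smooth_fun_on A (U \<inter> W) (\<lambda>q. f q + h q)"
    using U W by (intro smooth_fun_on_add) (auto intro: smooth_fun_on_subset)
  then show ?thesis using U W by (intro smooth_atI[of "U \<inter> W"]) auto
qed

lemma smooth_at_imp_differentiable:
  assumes "c \<in> A" "p \<in> fst c" "smooth_at A p f"
  shows "(f \<circ> chart_inv c) differentiable (at (snd c p))"
proof -
  obtain U where U: "open U" "p \<in> U" "smooth_fun_on A U f"
    using assms(3) unfolding smooth_at_def by blast
  then show ?thesis
    using assms(1,2) smooth_on_imp_differentiable unfolding smooth_fun_on_def by blast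
qed

text \<open>The chain rule for the transition map. It makes the tangent space the range of a single
  linear map, whichever chart is used, and hence a vector space.\<close>

lemma chart_tvec_change:
  assumes c: "c \<in> A" "p \<in> fst c" and c': "c' \<in> A" "p \<in> fst c'"
  shows "chart_tvec A c' p w =
    chart_tvec A c p (frechet_derivative (snd c \<circ> chart_inv c') (at (snd c' p)) w)"
proof
  fix f
  let ?\<tau> = "snd c \<circ> chart_inv c'" and ?x = "snd c' p" and ?S = "snd c' ` (fst c \<inter> fst c')"
  show "chart_tvec A c' p w f = chart_tvec A c p (frechet_derivative ?\<tau> (at ?x) w) f"
  proof (cases "smooth_at A p f")
    case True
    have S: "open ?S" "?x \<in> ?S"
      using open_chart_image[OF c'(1) open_chart_domain[OF c(1)]] c c' by auto
    have \<tau>: "(?\<tau> has_derivative frechet_derivative ?\<tau> (at ?x)) (at ?x)"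
      using smooth_on_imp_differentiable[OF compatible[OF c'(1) c(1)]] c c'
      by (auto simp: frechet_derivative_works[THEN iffD1])
    have "((f \<circ> chart_inv c) has_derivative frechet_derivative (f \<circ> chart_inv c) (at (snd c p)))
        (at (?\<tau> ?x))"
      using smooth_at_imp_differentiable[OF c True] c' by (simp add: frechet_derivative_works[THEN iffD1])
    from has_derivative_compose[OF \<tau> this]
    have "((\<lambda>y. (f \<circ> chart_inv c) (?\<tau> y)) has_derivative
        (\<lambda>w. frechet_derivative (f \<circ> chart_inv c) (at (snd c p)) (frechet_derivative ?\<tau> (at ?x) w)))
        (at ?x)" by simp
    then have "((f \<circ> chart_inv c') has_derivative
        (\<lambda>w. frechet_derivative (f \<circ> chart_inv c) (at (snd c p)) (frechet_derivative ?\<tau> (at ?x) w)))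
        (at ?x)"
      by (rule has_derivative_transform_within_open[OF _ S]) (use c c' in auto)
    from frechet_derivative_at[OF this] show ?thesis
      using True by (simp add: chart_tvec_def) metis
  qed (simp add: chart_tvec_def)
qed

lemma tangent_space_eq_range:
  assumes c: "c \<in> A" "p \<in> fst c"
  shows "tangent_space A p = range (chart_tvec A c p)"
  using chart_tvec_change[OF c] c unfolding tangent_space_def by blast

lemma linear_chart_tvec:
  assumes c: "c \<in> A" "p \<in> fst c"
  shows "linear (chart_tvec A c p)"
proof -
  have lin: "linear (frechet_derivative (f \<circ> chart_inv c) (at (snd c p)))" if "smooth_at A p f" for f
    using smooth_at_imp_differentiable[OF c that] by (rule linear_frechet_derivative)
  show ?thesis
    by (rule linearI)
      (auto simp: chart_tvec_def fun_eq_iff scaleR_fun_def linear_add[OF lin] linear_scale[OF lin])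
qed

text \<open>The images of the basis vectors could coincide, hence the inequality. This upper bound
  on the dimension forces independent families of \<open>CARD('d)\<close> tangent vectors to
  span.\<close>

lemma tangent_space_span:
  obtains B where "finite B" "card B \<le> CARD('d)" "tangent_space A p = span B"
proof -
  obtain c where c: "c \<in> A" "p \<in> fst c" by (rule chart_exists)
  let ?B = "chart_tvec A c p ` (Basis :: (real ^ 'd) set)"
  have "tangent_space A p = chart_tvec A c p ` span Basis"
    using tangent_space_eq_range[OF c] by simp
  also have "\<dots> = span ?B" by (rule linear_span_image[OF linear_chart_tvec[OF c], symmetric])
  finally have "tangent_space A p = span ?B" .
  moreover have "card ?B \<le> CARD('d)"
    using card_image_le[of "Basis :: (real ^ 'd) set" "chart_tvec A c p"] by simp
  ultimately show ?thesis using that[of ?B] by simp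
qed

lemma subspace_tangent_space [simp]: "subspace (tangent_space A p)"
  using tangent_space_span by (metis subspace_span)

text \<open>Tangent vectors are local. The statement includes functions that are not smooth at
  \<open>p\<close>: then neither of the two is, and both values are the default 0.\<close>

lemma tangent_vector_cong:
  assumes v: "v \<in> tangent_space A p" and U: "open U" "p \<in> U"
    and eq: "\<And>q. q \<in> U \<Longrightarrow> f q = h q"
  shows "v f = v h"
proof -
  obtain c w where c: "c \<in> A" "p \<in> fst c" and v_eq: "v = chart_tvec A c p w"
    using v unfolding tangent_space_def by blast
  have "frechet_derivative (f \<circ> chart_inv c) (at (snd c p)) =
      frechet_derivative (h \<circ> chart_inv c) (at (snd c p))"
    by (rule frechet_derivative_cong_open(2)[OF open_chart_image[OF c(1) U(1)]])
      (use c U eq in auto)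
  then show ?thesis
    using smooth_at_cong[OF U eq] by (simp add: v_eq chart_tvec_def)
qed

lemma tangent_vector_const:
  assumes v: "v \<in> tangent_space A p" and U: "open U" "p \<in> U"
    and eq: "\<And>q. q \<in> U \<Longrightarrow> f q = r"
  shows "v f = 0"
proof -
  have "v (\<lambda>q. r) = 0"
    using v by (auto simp: tangent_space_def chart_tvec_def comp_def)
  then show ?thesis using tangent_vector_cong[OF v U, of f "\<lambda>q. r"] eq by simp
qed

lemma tangent_vector_add:
  assumes v: "v \<in> tangent_space A p" and f: "smooth_at A p f" and h: "smooth_at A p h"
  shows "v (\<lambda>q. f q + h q) = v f + v h"
proof -
  obtain c w where c: "c \<in> A" "p \<in> fst c" and v_eq: "v = chart_tvec A c p w"
    using v unfolding tangent_space_def by blast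
  have "((\<lambda>x. (f \<circ> chart_inv c) x + (h \<circ> chart_inv c) x) has_derivative
      (\<lambda>w. frechet_derivative (f \<circ> chart_inv c) (at (snd c p)) w +
        frechet_derivative (h \<circ> chart_inv c) (at (snd c p)) w)) (at (snd c p))"
    using smooth_at_imp_differentiable[OF c f] smooth_at_imp_differentiable[OF c h]
    by (intro has_derivative_add frechet_derivative_works[THEN iffD1])
  from frechet_derivative_at[OF this, symmetric] show ?thesis
    using f h smooth_at_add[OF f h] by (simp add: v_eq chart_tvec_def comp_def)
qed

section \<open>Smooth vector fields on open sets\<close>

lemma smooth_vfield_onD:
  assumes "smooth_vfield_on A U X"
  shows "p \<in> U \<Longrightarrow> X p \<in> tangent_space A p"
    and "open U \<Longrightarrow> smooth_fun_on A U f \<Longrightarrow> smooth_fun_on A U (\<lambda>p. X p f)"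
  using assms unfolding smooth_vfield_on_def by auto

lemma smooth_vfield_on_subset: "smooth_vfield_on A U X \<Longrightarrow> W \<subseteq> U \<Longrightarrow> smooth_vfield_on A W X"
  unfolding smooth_vfield_on_def by (meson subsetD subset_trans)

lemma smooth_vfield_on_cong:
  assumes "open U" "\<And>q. q \<in> U \<Longrightarrow> X q = Y q"
  shows "smooth_vfield_on A U X \<longleftrightarrow> smooth_vfield_on A U Y"
proof -
  have "smooth_fun_on A W (\<lambda>p. X p f) \<longleftrightarrow> smooth_fun_on A W (\<lambda>p. Y p f)"
    if "open W" "W \<subseteq> U" for W f
    using that assms(2) by (intro smooth_fun_on_cong) auto
  then show ?thesis unfolding smooth_vfield_on_def using assms(2) by auto
qed

lemma smooth_vfield_on_add:
  assumes "smooth_vfield_on A U X" "smooth_vfield_on A U Y"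
  shows "smooth_vfield_on A U (\<lambda>q. X q + Y q)"
  using assms unfolding smooth_vfield_on_def
  by (auto intro: subspace_add[OF subspace_tangent_space] smooth_fun_on_add)

lemma smooth_vfield_on_scale:
  assumes f: "smooth_fun_on A U f" and X: "smooth_vfield_on A U X"
  shows "smooth_vfield_on A U (\<lambda>q. f q *\<^sub>R X q)"
  unfolding smooth_vfield_on_def
proof (intro conjI ballI allI impI)
  show "f p *\<^sub>R X p \<in> tangent_space A p" if "p \<in> U" for p
    using X that by (auto intro: subspace_scale[OF subspace_tangent_space] smooth_vfield_onD)
  fix W h assume W: "open W \<and> W \<subseteq> U \<and> smooth_fun_on A W h"
  then have "smooth_fun_on A W (\<lambda>p. f p * X p h)"
    using X smooth_fun_on_subset[OF f]
    by (intro smooth_fun_on_mult) (auto simp: smooth_vfield_on_def)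
  then show "smooth_fun_on A W (\<lambda>p. (f p *\<^sub>R X p) h)" by (simp add: scaleR_fun_def)
qed

lemma smooth_vfield_on_zero: "smooth_vfield_on A U (\<lambda>q. 0)"
  unfolding smooth_vfield_on_def by (auto intro: subspace_0[OF subspace_tangent_space])

lemma smooth_vfield_on_sum:
  assumes "\<And>i. i \<in> I \<Longrightarrow> smooth_vfield_on A U (X i)"
  shows "smooth_vfield_on A U (\<lambda>q. \<Sum>i\<in>I. X i q)"
proof (cases "finite I")
  case True
  then show ?thesis using assms
    by (induction I rule: finite_induct) (auto intro: smooth_vfield_on_add smooth_vfield_on_zero)
qed (simp add: smooth_vfield_on_zero)

lemma smooth_vfield_on_diff:
  assumes "smooth_vfield_on A U X" "smooth_vfield_on A U Y"
  shows "smooth_vfield_on A U (\<lambda>q. X q - Y q)"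
  using smooth_vfield_on_add[OF assms(1) smooth_vfield_on_scale[OF smooth_fun_on_const[of U "-1"] assms(2)]]
  by simp

lemma smooth_vfield_on_coordinate:
  assumes c: "c \<in> A"
  shows "smooth_vfield_on A (fst c) (\<lambda>q. chart_tvec A c q w)"
  unfolding smooth_vfield_on_def
proof (intro conjI ballI allI impI)
  show "chart_tvec A c p w \<in> tangent_space A p" if "p \<in> fst c" for p
    using c that unfolding tangent_space_def by blast
  fix W f assume W: "open W \<and> W \<subseteq> fst c \<and> smooth_fun_on A W f"
  have oW: "open (snd c ` W)"
    using open_chart_image[OF c, of W] W by (simp add: Int_absorb2)
  have "smooth_on (snd c ` W) (f \<circ> chart_inv c)"
    using W c unfolding smooth_fun_on_def by (metis Int_absorb2)
  then have "smooth_on (snd c ` W) (\<lambda>x. frechet_derivative (f \<circ> chart_inv c) (at x) w)"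
    by (rule smooth_on_frechet_derivative)
  then have "smooth_on (snd c ` W) ((\<lambda>q. chart_tvec A c q w f) \<circ> chart_inv c)"
  proof (rule smooth_on_cong[OF oW, THEN iffD1, rotated])
    fix x assume "x \<in> snd c ` W"
    then obtain q where q: "q \<in> W" "x = snd c q" by blast
    \<comment> \<open>Since \<open>f\<close> is smooth on \<open>W\<close>, it is smooth at every
      point of \<open>W\<close>, and the default branch of \<open>chart_tvec\<close> does not
      occur.\<close>
    then show "frechet_derivative (f \<circ> chart_inv c) (at x) w =
        ((\<lambda>q. chart_tvec A c q w f) \<circ> chart_inv c) x"
      using W c smooth_atI[of W q f] by (auto simp: chart_tvec_def)
  qed
  then show "smooth_fun_on A W (\<lambda>q. chart_tvec A c q w f)"
    using W c by (intro smooth_fun_on_chartI[OF c]) auto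
qed

lemma tangent_vector_extension:
  assumes "v \<in> tangent_space A p"
  obtains U V where "open U" "p \<in> U" "smooth_vfield_on A U V" "V p = v"
proof -
  obtain c w where c: "c \<in> A" "p \<in> fst c" and "v = chart_tvec A c p w"
    using assms unfolding tangent_space_def by blast
  then show ?thesis
    using that[OF open_chart_domain[OF c(1)] c(2) smooth_vfield_on_coordinate[OF c(1)]] by simp
qed

end

section \<open>Pseudo-orthonormal bases and traces\<close>

lemma linear_on_sum:
  assumes "subspace V" "linear_on V L" "\<And>i. i \<in> I \<Longrightarrow> v i \<in> V"
  shows "L (\<Sum>i\<in>I. r i *\<^sub>R v i) = (\<Sum>i\<in>I. r i *\<^sub>R L (v i))"
proof -
  have 0: "L 0 = 0"
    using assms(2) subspace_0[OF assms(1)] unfolding linear_on_def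
    by (metis scaleR_zero_left)
  show ?thesis
  proof (cases "finite I")
    case True
    then show ?thesis using assms(3)
    proof (induction I rule: finite_induct)
      case (insert i I)
      have "r i *\<^sub>R v i \<in> V" "(\<Sum>i\<in>I. r i *\<^sub>R v i) \<in> V"
        using insert.prems assms(1) by (auto intro: subspace_scale subspace_sum)
      then have "L (r i *\<^sub>R v i + (\<Sum>i\<in>I. r i *\<^sub>R v i)) = L (r i *\<^sub>R v i) + L (\<Sum>i\<in>I. r i *\<^sub>R v i)"
        using assms(2) unfolding linear_on_def by blast
      moreover have "L (r i *\<^sub>R v i) = r i *\<^sub>R L (v i)"
        using assms(2) insert.prems unfolding linear_on_def by blast
      ultimately show ?case using insert by simp
    qed (simp add: 0)
  qed (simp add: 0)
qed

text \<open>The condition on coefficients also excludes repetitions in the indexed family: if two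
  members agreed, the difference of two Kronecker deltas would be a nontrivial relation.\<close>

lemma
  fixes e :: "'i::finite \<Rightarrow> 'a::real_vector"
  assumes e: "\<And>r j. (\<Sum>i\<in>UNIV. r i *\<^sub>R e i) = 0 \<Longrightarrow> r j = 0"
  shows inj_independent_family: "inj e"
    and independent_range_family: "independent (range e)"
proof -
  show inj: "inj e"
  proof (rule injI, rule ccontr)
    fix i j assume ij: "e i = e j" "i \<noteq> j"
    let ?r = "\<lambda>k. (if k = i then 1 else 0) - (if k = j then 1 else 0) :: real"
    have "(\<Sum>k\<in>UNIV. ?r k *\<^sub>R e k) = 0"
      using ij(1) by (simp add: scaleR_diff_left sum_subtractf if_distrib[of "\<lambda>x. x *\<^sub>R _"] cong: if_cong)
    then have "?r i = 0" by (rule e)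
    then show False using ij(2) by simp
  qed
  show "independent (range e)"
  proof (rule independent_if_scalars_zero)
    fix f x assume f: "(\<Sum>x\<in>range e. f x *\<^sub>R x) = 0" and "x \<in> range e"
    then obtain j where j: "x = e j" by blast
    have "(\<Sum>i\<in>UNIV. f (e i) *\<^sub>R e i) = 0"
      using f by (simp add: sum.reindex[OF inj])
    then show "f x = 0" unfolding j by (rule e)
  qed simp
qed

lemma span_range_family:
  fixes e :: "'i::finite \<Rightarrow> 'a::real_vector"
  assumes "inj e" "v \<in> span (range e)"
  obtains r where "v = (\<Sum>i\<in>UNIV. r i *\<^sub>R e i)"
proof -
  obtain u where "v = (\<Sum>w\<in>range e. u w *\<^sub>R w)"
    using assms(2) span_finite[of "range e"] by auto
  then have "v = (\<Sum>i\<in>UNIV. u (e i) *\<^sub>R e i)"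
    by (simp add: sum.reindex[OF assms(1)])
  then show ?thesis by (rule that)
qed

lemma basis_of_subspace:
  fixes V :: "'a::real_vector set"
  assumes "subspace V"
  shows "\<exists>B. independent B \<and> span B = V"
proof -
  obtain B where "B \<subseteq> V" "independent B" "V \<subseteq> span B"
    by (rule maximal_independent_subset)
  then show ?thesis using span_minimal[OF _ assms] by blast
qed

context pseudo_riemannian_manifold
begin

lemma metric_sum_right:
  assumes "u \<in> tangent_space A p" "\<And>i. i \<in> I \<Longrightarrow> v i \<in> tangent_space A p"
  shows "g p u (\<Sum>i\<in>I. r i *\<^sub>R v i) = (\<Sum>i\<in>I. r i * g p u (v i))"
  using linear_on_sum[OF subspace_tangent_space metric_linear[OF assms(1)], of I v r] assms(2) by simp

lemma tangent_sum:
  "(\<And>i. i \<in> I \<Longrightarrow> v i \<in> tangent_space A p) \<Longrightarrow> (\<Sum>i\<in>I. r i *\<^sub>R v i) \<in> tangent_space A p"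
  by (intro subspace_sum subspace_scale subspace_tangent_space)

lemma metric_sum_left:
  assumes "u \<in> tangent_space A p" "\<And>i. i \<in> I \<Longrightarrow> v i \<in> tangent_space A p"
  shows "g p (\<Sum>i\<in>I. r i *\<^sub>R v i) u = (\<Sum>i\<in>I. r i * g p (v i) u)"
  using metric_sum_right[OF assms] metric_sym[OF tangent_sum[of I v p r] assms(1)]
    metric_sym[OF assms(2) assms(1)] assms(2) by simp

lemma
  assumes "u \<in> tangent_space A p" "v \<in> tangent_space A p" "w \<in> tangent_space A p"
  shows metric_add_right: "g p u (v + w) = g p u v + g p u w"
    and metric_add_left: "g p (v + w) u = g p v u + g p w u"
    and metric_diff_right: "g p u (v - w) = g p u v - g p u w"
    and metric_diff_left: "g p (v - w) u = g p v u - g p w u"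
    and metric_scale_right: "g p u (r *\<^sub>R v) = r * g p u v"
    and metric_scale_left: "g p (r *\<^sub>R v) u = r * g p v u"
proof -
  have *: "(\<Sum>i\<in>{True, False}. (if i then 1 else s) *\<^sub>R (if i then v else w)) = v + s *\<^sub>R w" for s
    by simp
  show "g p u (v + w) = g p u v + g p u w" "g p u (v - w) = g p u v - g p u w"
    using metric_sum_right[OF assms(1), of "{True, False}" "\<lambda>i. if i then v else w"
        "\<lambda>i. if i then 1 else 1"] assms
      metric_sum_right[OF assms(1), of "{True, False}" "\<lambda>i. if i then v else w"
        "\<lambda>i. if i then 1 else - 1"] by auto
  show "g p (v + w) u = g p v u + g p w u" "g p (v - w) u = g p v u - g p w u"
    using metric_sum_left[OF assms(1), of "{True, False}" "\<lambda>i. if i then v else w"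
        "\<lambda>i. if i then 1 else 1"] assms
      metric_sum_left[OF assms(1), of "{True, False}" "\<lambda>i. if i then v else w"
        "\<lambda>i. if i then 1 else - 1"] by auto
  show "g p u (r *\<^sub>R v) = r * g p u v" "g p (r *\<^sub>R v) u = r * g p v u"
    using metric_sum_right[OF assms(1), of "{()}" "\<lambda>_. v" "\<lambda>_. r"]
      metric_sum_left[OF assms(1), of "{()}" "\<lambda>_. v" "\<lambda>_. r"] assms by auto
qed

definition orthonormal_at :: "'m \<Rightarrow> ('d \<Rightarrow> 'm tvec) \<Rightarrow> ('d \<Rightarrow> real) \<Rightarrow> bool"
  where "orthonormal_at p e \<epsilon> \<longleftrightarrow> (\<forall>i. e i \<in> tangent_space A p) \<and> (\<forall>i. \<epsilon> i * \<epsilon> i = 1) \<and>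
           (\<forall>i j. g p (e i) (e j) = (if i = j then \<epsilon> i else 0))"

text \<open>Pairing a linear combination with \<open>e j\<close> recovers its coefficient up to
  sign, so the family is independent. A vector outside its span would give more independent vectors
  than the dimension allows.\<close>

lemma orthonormal_expansion:
  assumes e: "orthonormal_at p e \<epsilon>" and v: "v \<in> tangent_space A p"
  shows "v = (\<Sum>i\<in>UNIV. (\<epsilon> i * g p v (e i)) *\<^sub>R e i)"
proof -
  have eT: "e i \<in> tangent_space A p" and \<epsilon>: "\<epsilon> i * \<epsilon> i = 1"
    and ee: "g p (e i) (e j) = (if i = j then \<epsilon> i else 0)" for i j
    using e unfolding orthonormal_at_def by auto
  have coeff: "g p (\<Sum>i\<in>UNIV. r i *\<^sub>R e i) (e j) = r j * \<epsilon> j" for r j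
    using eT by (simp add: metric_sum_left ee if_distrib[of "\<lambda>x. _ * x"] cong: if_cong)
  have fam: "r j = 0" if "(\<Sum>i\<in>UNIV. r i *\<^sub>R e i) = 0" for r j
  proof -
    have "g p 0 (e j) = 0"
      using metric_sum_left[OF eT[of j], of "{}"] by simp
    then have "r j * \<epsilon> j = 0" using coeff[of r j] that by simp
    then show ?thesis using \<epsilon>[of j] by auto
  qed
  have inj: "inj e" by (rule inj_independent_family) (rule fam)
  have span: "v \<in> span (range e)"
  proof (rule ccontr)
    assume "v \<notin> span (range e)"
    moreover have "independent (range e)" by (rule independent_range_family) (rule fam)
    ultimately have ind: "independent (insert v (range e))"
      by (rule independent_insertI)
    obtain B where B: "finite B" "card B \<le> CARD('d)" "tangent_space A p = span B"
      by (rule tangent_space_span)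
    have "card (insert v (range e)) \<le> card B"
      using real_vector.independent_span_bound[OF B(1) ind] B(3) v eT by auto
    moreover have "v \<notin> range e" using \<open>v \<notin> span (range e)\<close> span_base[of v "range e"] by argo
    then have "card (insert v (range e)) = Suc CARD('d)"
      using card_image[OF inj] by simp
    ultimately show False using B(2) by simp
  qed
  obtain u where v_eq: "v = (\<Sum>i\<in>UNIV. u i *\<^sub>R e i)"
    using inj span by (rule span_range_family)
  have "\<epsilon> i * g p v (e i) = u i" for i
    using coeff[of u i] \<epsilon>[of i] unfolding v_eq[symmetric] by simp
  then show ?thesis using v_eq by simp
qed

lemma orthonormal_metric_expansion:
  assumes e: "orthonormal_at p e \<epsilon>" and u: "u \<in> tangent_space A p" and v: "v \<in> tangent_space A p"
  shows "g p u v = (\<Sum>i\<in>UNIV. \<epsilon> i * g p u (e i) * g p v (e i))"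
proof -
  have eT: "e i \<in> tangent_space A p" for i using e unfolding orthonormal_at_def by auto
  have "g p u v = g p u (\<Sum>i\<in>UNIV. (\<epsilon> i * g p v (e i)) *\<^sub>R e i)"
    using orthonormal_expansion[OF e v] by simp
  then show ?thesis using u eT by (simp add: metric_sum_right mult_ac)
qed

text \<open>The basis \<open>B\<close> in \<open>trace_on\<close> is an unknown choice. Expanding
  each of its vectors in \<open>e\<close> and exchanging the sums reassembles \<open>L (e i)\<close>
  from its coordinates in \<open>B\<close>, so that \<open>B\<close> disappears.\<close>

lemma trace_on_tangent_space:
  assumes e: "orthonormal_at p e \<epsilon>"
    and L: "linear_on (tangent_space A p) L" "L ` tangent_space A p \<subseteq> tangent_space A p"
  shows "trace_on (tangent_space A p) L = (\<Sum>i\<in>UNIV. \<epsilon> i * g p (L (e i)) (e i))"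
proof -
  let ?T = "tangent_space A p"
  define B where "B = (SOME B. independent B \<and> span B = ?T)"
  have eT: "e i \<in> ?T" for i using e unfolding orthonormal_at_def by auto
  have B: "independent B" "span B = ?T"
    using someI_ex[OF basis_of_subspace[OF subspace_tangent_space]] unfolding B_def by auto
  have BT: "b \<in> ?T" if "b \<in> B" for b using B(2) span_base[OF that] by simp
  obtain C where "finite C" "?T = span C" by (rule tangent_space_span)
  then have fin: "finite B"
    using real_vector.independent_span_bound[of C B] B BT by auto
  have LT: "L v \<in> span B" if "v \<in> ?T" for v using L(2) B(2) that by auto
  have rep: "representation B (L b) b =
      (\<Sum>i\<in>UNIV. (\<epsilon> i * g p b (e i)) * representation B (L (e i)) b)" if "b \<in> B" for b
  proof -
    have "L b = L (\<Sum>i\<in>UNIV. (\<epsilon> i * g p b (e i)) *\<^sub>R e i)"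
      using orthonormal_expansion[OF e BT[OF that]] by simp
    also have "\<dots> = (\<Sum>i\<in>UNIV. (\<epsilon> i * g p b (e i)) *\<^sub>R L (e i))"
      by (rule linear_on_sum[OF subspace_tangent_space L(1) eT])
    finally show ?thesis
      using LT[OF eT] by (simp add: representation_sum[OF B(1)] representation_scale[OF B(1)] span_scale)
  qed
  have "trace_on ?T L = (\<Sum>b\<in>B. representation B (L b) b)"
    unfolding trace_on_def B_def by (simp add: Let_def)
  also have "\<dots> = (\<Sum>b\<in>B. \<Sum>i\<in>UNIV. (\<epsilon> i * g p b (e i)) * representation B (L (e i)) b)"
    using rep by (rule sum.cong[OF refl])
  also have "\<dots> = (\<Sum>i\<in>UNIV. \<epsilon> i * (\<Sum>b\<in>B. representation B (L (e i)) b * g p b (e i)))"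
    by (subst sum.swap) (simp add: sum_distrib_left mult_ac)
  also have "\<dots> = (\<Sum>i\<in>UNIV. \<epsilon> i * g p (\<Sum>b\<in>B. representation B (L (e i)) b *\<^sub>R b) (e i))"
    using BT eT by (simp add: metric_sum_left)
  also have "\<dots> = (\<Sum>i\<in>UNIV. \<epsilon> i * g p (L (e i)) (e i))"
    using LT[OF eT] by (simp add: sum_representation_eq[OF B(1) _ fin order_refl])
  finally show ?thesis .
qed

text \<open>The metric trace of a bilinear map with vector values does not depend on the orthonormal
  basis, because summing \<delta>_i g(e_j, f_i) g(e_k, f_i) over i gives g(e_j, e_k). The map is
  presented by its components \<open>t j k\<close> in the basis \<open>e\<close>.\<close>

lemma orthonormal_trace_unique:
  assumes e: "orthonormal_at p e \<epsilon>" and f: "orthonormal_at p f \<delta>"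
    and T: "\<And>u v. u \<in> tangent_space A p \<Longrightarrow> v \<in> tangent_space A p \<Longrightarrow> T u v =
      (\<Sum>j\<in>UNIV. \<Sum>k\<in>UNIV. (\<epsilon> j * g p u (e j) * (\<epsilon> k * g p v (e k))) *\<^sub>R (t j k :: 'b::real_vector))"
  shows "(\<Sum>i\<in>UNIV. \<delta> i *\<^sub>R T (f i) (f i)) = (\<Sum>i\<in>UNIV. \<epsilon> i *\<^sub>R t i i)"
proof -
  have eT: "e i \<in> tangent_space A p" and \<epsilon>: "\<epsilon> i * \<epsilon> i = 1"
    and ee: "g p (e i) (e j) = (if i = j then \<epsilon> i else 0)" and fT: "f i \<in> tangent_space A p" for i j
    using e f unfolding orthonormal_at_def by auto
  have "(\<Sum>i\<in>UNIV. \<delta> i *\<^sub>R T (f i) (f i)) =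
      (\<Sum>i\<in>UNIV. \<Sum>j\<in>UNIV. \<Sum>k\<in>UNIV. (\<epsilon> j * \<epsilon> k * (\<delta> i * g p (e j) (f i) * g p (e k) (f i))) *\<^sub>R t j k)"
    using T[OF fT fT] metric_sym[OF fT eT] by (simp add: scaleR_sum_right mult_ac)
  also have "\<dots> = (\<Sum>j\<in>UNIV. \<Sum>i\<in>UNIV. \<Sum>k\<in>UNIV. (\<epsilon> j * \<epsilon> k * (\<delta> i * g p (e j) (f i) * g p (e k) (f i))) *\<^sub>R t j k)"
    by (rule sum.swap)
  also have "\<dots> = (\<Sum>j\<in>UNIV. \<Sum>k\<in>UNIV. \<Sum>i\<in>UNIV. (\<epsilon> j * \<epsilon> k * (\<delta> i * g p (e j) (f i) * g p (e k) (f i))) *\<^sub>R t j k)"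
    by (rule sum.cong[OF refl]) (rule sum.swap)
  also have "\<dots> = (\<Sum>j\<in>UNIV. \<Sum>k\<in>UNIV. (\<epsilon> j * \<epsilon> k * g p (e j) (e k)) *\<^sub>R t j k)"
    using orthonormal_metric_expansion[OF f eT eT]
    by (simp add: sum_distrib_left scaleR_sum_left[symmetric])
  also have "\<dots> = (\<Sum>j\<in>UNIV. \<Sum>k\<in>UNIV. (if j = k then \<epsilon> j else 0) *\<^sub>R t j k)"
    using \<epsilon> by (intro sum.cong refl) (auto simp: ee)
  also have "\<dots> = (\<Sum>j\<in>UNIV. \<epsilon> j *\<^sub>R t j j)"
    by (simp add: if_distrib[of "\<lambda>x. x *\<^sub>R _"] cong: if_cong)
  finally show ?thesis .
qed

lemma frame_orthonormal_at:
  assumes frame: "pseudo_orthonormal_frame_on A g U e \<epsilon>" and p: "p \<in> U"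
  shows "orthonormal_at p (\<lambda>i. e i p) \<epsilon>"
  unfolding orthonormal_at_def
proof (intro conjI allI)
  fix i j
  show "e i p \<in> tangent_space A p"
    using frame p unfolding pseudo_orthonormal_frame_on_def by (metis smooth_vfield_onD(1))
  have "\<epsilon> i \<in> {1, -1}"
    using frame unfolding pseudo_orthonormal_frame_on_def by metis
  then show "\<epsilon> i * \<epsilon> i = 1" by auto
  show "g p (e i p) (e j p) = (if i = j then \<epsilon> i else 0)"
    using frame p unfolding pseudo_orthonormal_frame_on_def by metis
qed

lemma frame_subset:
  "pseudo_orthonormal_frame_on A g U e \<epsilon> \<Longrightarrow> W \<subseteq> U \<Longrightarrow> pseudo_orthonormal_frame_on A g W e \<epsilon>"
  unfolding pseudo_orthonormal_frame_on_def by (meson smooth_vfield_on_subset subsetD)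

end

section \<open>Tensorial operations\<close>

context pseudo_riemannian_manifold
begin

definition frame_coeff :: "('d \<Rightarrow> 'm vfield) \<Rightarrow> ('d \<Rightarrow> real) \<Rightarrow> 'm vfield \<Rightarrow> 'd \<Rightarrow> 'm \<Rightarrow> real"
  where "frame_coeff e \<epsilon> X i q = \<epsilon> i * g q (X q) (e i q)"

lemma frame_smooth:
  "pseudo_orthonormal_frame_on A g U e \<epsilon> \<Longrightarrow> smooth_vfield_on A U (e i)"
  unfolding pseudo_orthonormal_frame_on_def by simp

lemma frame_coeff_smooth:
  assumes "open U" "pseudo_orthonormal_frame_on A g U e \<epsilon>" "smooth_vfield_on A U X"
  shows "smooth_fun_on A U (frame_coeff e \<epsilon> X i)"
  unfolding frame_coeff_def
  by (intro smooth_fun_on_mult smooth_fun_on_const metric_smooth assms frame_smooth[OF assms(2)])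

lemma frame_expansion:
  assumes "pseudo_orthonormal_frame_on A g U e \<epsilon>" "q \<in> U" "v \<in> tangent_space A q"
  shows "v = (\<Sum>i\<in>UNIV. (\<epsilon> i * g q v (e i q)) *\<^sub>R e i q)"
  by (rule orthonormal_expansion[OF frame_orthonormal_at[OF assms(1,2)] assms(3)])

text \<open>Linearity over the smooth functions on \<open>U\<close>, for operators whose result is
  already evaluated at \<open>p\<close>: a factor \<open>f\<close> leaves as the number
  \<open>f p\<close>.\<close>

definition tensorial_at :: "'m set \<Rightarrow> 'm \<Rightarrow> ('m vfield \<Rightarrow> 'b::real_vector) \<Rightarrow> bool"
  where "tensorial_at U p T \<longleftrightarrow>
           (\<forall>X Y. smooth_vfield_on A U X \<longrightarrow> smooth_vfield_on A U Y \<longrightarrow>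
              T (\<lambda>q. X q + Y q) = T X + T Y) \<and>
           (\<forall>f X. smooth_fun_on A U f \<longrightarrow> smooth_vfield_on A U X \<longrightarrow>
              T (\<lambda>q. f q *\<^sub>R X q) = f p *\<^sub>R T X)"

lemma
  assumes "tensorial_at U p T"
  shows tensorial_at_add: "smooth_vfield_on A U X \<Longrightarrow> smooth_vfield_on A U Y \<Longrightarrow>
      T (\<lambda>q. X q + Y q) = T X + T Y"
    and tensorial_at_scale: "smooth_fun_on A U f \<Longrightarrow> smooth_vfield_on A U X \<Longrightarrow>
      T (\<lambda>q. f q *\<^sub>R X q) = f p *\<^sub>R T X"
  using assms unfolding tensorial_at_def by simp_all

text \<open>Fields that agree on \<open>U\<close> may differ as total functions. The indicator of
  \<open>U\<close> is smooth on \<open>U\<close>, being constant there, and multiplying by it makes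
  the two fields equal in HOL without changing the value of \<open>T\<close>.\<close>

lemma tensorial_at_cong:
  assumes T: "tensorial_at U p T" and U: "open U" "p \<in> U"
    and X: "smooth_vfield_on A U X" and Y: "smooth_vfield_on A U Y"
    and eq: "\<And>q. q \<in> U \<Longrightarrow> X q = Y q"
  shows "T X = T Y"
proof -
  let ?f = "indicator U :: 'm \<Rightarrow> real"
  have f: "smooth_fun_on A U ?f"
    by (rule smooth_fun_on_cong[OF U(1), THEN iffD1, OF _ smooth_fun_on_const[of U 1]]) simp
  have "T (\<lambda>q. ?f q *\<^sub>R Z q) = T Z" if "smooth_vfield_on A U Z" for Z
    using tensorial_at_scale[OF T f that] U(2) by simp
  moreover have "(\<lambda>q. ?f q *\<^sub>R X q) = (\<lambda>q. ?f q *\<^sub>R Y q)"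
    using eq by (auto simp: fun_eq_iff indicator_def)
  ultimately show ?thesis using X Y by metis
qed

lemma tensorial_at_sum:
  assumes T: "tensorial_at U p T"
    and X: "\<And>i. i \<in> I \<Longrightarrow> smooth_vfield_on A U (X i)"
    and f: "\<And>i. i \<in> I \<Longrightarrow> smooth_fun_on A U (f i)"
  shows "T (\<lambda>q. \<Sum>i\<in>I. f i q *\<^sub>R X i q) = (\<Sum>i\<in>I. f i p *\<^sub>R T (X i))"
proof -
  have 0: "T (\<lambda>q. 0) = 0"
    using tensorial_at_scale[OF T smooth_fun_on_const[of U 0] smooth_vfield_on_zero] by simp
  show ?thesis
  proof (cases "finite I")
    case True
    then show ?thesis using X f
    proof (induction I rule: finite_induct)
      case (insert i I)
      have "smooth_vfield_on A U (\<lambda>q. f i q *\<^sub>R X i q)"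
        using insert.prems by (simp add: smooth_vfield_on_scale)
      moreover have "smooth_vfield_on A U (\<lambda>q. \<Sum>i\<in>I. f i q *\<^sub>R X i q)"
        using insert.prems by (intro smooth_vfield_on_sum smooth_vfield_on_scale) auto
      ultimately have "T (\<lambda>q. f i q *\<^sub>R X i q + (\<Sum>i\<in>I. f i q *\<^sub>R X i q)) =
          T (\<lambda>q. f i q *\<^sub>R X i q) + T (\<lambda>q. \<Sum>i\<in>I. f i q *\<^sub>R X i q)"
        by (rule tensorial_at_add[OF T])
      moreover have "T (\<lambda>q. f i q *\<^sub>R X i q) = f i p *\<^sub>R T (X i)"
        using insert.prems by (intro tensorial_at_scale[OF T]) auto
      moreover have "T (\<lambda>q. \<Sum>i\<in>I. f i q *\<^sub>R X i q) = (\<Sum>i\<in>I. f i p *\<^sub>R T (X i))"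
        using insert.prems by (intro insert.IH) auto
      ultimately show ?case unfolding sum.insert[OF insert.hyps] by metis
    qed (simp add: 0)
  qed (simp add: 0)
qed

lemma tensorial_at_expansion:
  assumes T: "tensorial_at U p T" and U: "open U" "p \<in> U"
    and e: "pseudo_orthonormal_frame_on A g U e \<epsilon>" and X: "smooth_vfield_on A U X"
  shows "T X = (\<Sum>i\<in>UNIV. (\<epsilon> i * g p (X p) (e i p)) *\<^sub>R T (e i))"
proof -
  let ?Y = "\<lambda>q. \<Sum>i\<in>UNIV. frame_coeff e \<epsilon> X i q *\<^sub>R e i q"
  have "smooth_vfield_on A U ?Y"
    by (intro smooth_vfield_on_sum smooth_vfield_on_scale frame_coeff_smooth U e X frame_smooth[OF e])
  moreover have "X q = ?Y q" if "q \<in> U" for q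
    unfolding frame_coeff_def using frame_expansion[OF e that smooth_vfield_onD(1)[OF X that]] .
  ultimately have "T X = T ?Y"
    by (intro tensorial_at_cong[OF T U X])
  also have "\<dots> = (\<Sum>i\<in>UNIV. frame_coeff e \<epsilon> X i p *\<^sub>R T (e i))"
    by (intro tensorial_at_sum[OF T] frame_coeff_smooth U e X frame_smooth[OF e])
  finally show ?thesis unfolding frame_coeff_def .
qed

text \<open>Constant coefficients in the frame provide an extension on the prescribed set
  \<open>U\<close>, whereas \<open>tangent_vector_extension\<close> comes with a domain of its
  own.\<close>

lemma constant_extension:
  assumes U: "open U" "p \<in> U" and e: "pseudo_orthonormal_frame_on A g U e \<epsilon>"
    and v: "v \<in> tangent_space A p"
  obtains V where "smooth_vfield_on A U V" "V p = v"
proof -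
  let ?V = "\<lambda>q. \<Sum>i\<in>UNIV. (\<epsilon> i * g p v (e i p)) *\<^sub>R e i q"
  have "smooth_vfield_on A U ?V"
    by (intro smooth_vfield_on_sum smooth_vfield_on_scale smooth_fun_on_const frame_smooth[OF e])
  then show ?thesis using frame_expansion[OF e U(2) v] that[of ?V] by simp
qed

text \<open>On a function \<open>f\<close> all iterated derivatives cancel. The inner bracket
  applied to \<open>f\<close> is the commutator only where \<open>f\<close> is smooth, so the
  computation takes place on a smaller neighbourhood and uses that tangent vectors are
  local.\<close>

lemma jacobi_identity:
  assumes U: "open U" "p \<in> U" and X: "smooth_vfield_on A U X"
    and Y: "smooth_vfield_on A U Y" and Z: "smooth_vfield_on A U Z"
  shows "lie_bracket A X (lie_bracket A Y Z) p + lie_bracket A Y (lie_bracket A Z X) p +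
    lie_bracket A Z (lie_bracket A X Y) p = 0"
proof
  fix f
  show "(lie_bracket A X (lie_bracket A Y Z) p + lie_bracket A Y (lie_bracket A Z X) p +
    lie_bracket A Z (lie_bracket A X Y) p) f = 0 f"
  proof (cases "smooth_at A p f")
    case True
    then obtain W where W: "open W" "p \<in> W" "smooth_fun_on A W f"
      unfolding smooth_at_def by blast
    have V: "open (U \<inter> W)" "p \<in> U \<inter> W" using U W by auto
    have f: "smooth_fun_on A (U \<inter> W) f" using smooth_fun_on_subset[OF W(3)] by simp
    have field: "smooth_vfield_on A (U \<inter> W) X'" if "smooth_vfield_on A U X'" for X'
      using smooth_vfield_on_subset[OF that] by simp
    have *: "X' p (\<lambda>q. lie_bracket A Y' Z' q f) =
        X' p (\<lambda>q. Y' q (\<lambda>q. Z' q f)) - X' p (\<lambda>q. Z' q (\<lambda>q. Y' q f)) \<and>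
        lie_bracket A Y' Z' p (\<lambda>q. X' q f) =
        Y' p (\<lambda>q. Z' q (\<lambda>q. X' q f)) - Z' p (\<lambda>q. Y' q (\<lambda>q. X' q f))"
      if X': "smooth_vfield_on A U X'" and Y': "smooth_vfield_on A U Y'"
        and Z': "smooth_vfield_on A U Z'" for X' Y' Z'
    proof
      let ?h = "\<lambda>q. Y' q (\<lambda>q. Z' q f)" and ?k = "\<lambda>q. Z' q (\<lambda>q. Y' q f)"
      note D = smooth_vfield_onD(2)[OF field] 
      have h: "smooth_fun_on A (U \<inter> W) ?h" and k: "smooth_fun_on A (U \<inter> W) ?k"
        by (intro D[OF Y' V(1)] D[OF Z' V(1)] f)+
      have X'T: "X' p \<in> tangent_space A p" by (rule smooth_vfield_onD(1)[OF X' U(2)])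
      have "X' p ?h = X' p (\<lambda>q. lie_bracket A Y' Z' q f + ?k q)"
        by (rule tangent_vector_cong[OF X'T V])
          (use smooth_atI[OF V(1) _ f] in \<open>simp add: lie_bracket_def\<close>)
      also have "\<dots> = X' p (\<lambda>q. lie_bracket A Y' Z' q f) + X' p ?k"
      proof (rule tangent_vector_add[OF X'T])
        show "smooth_at A p ?k" by (rule smooth_atI[OF V k])
        have "smooth_fun_on A (U \<inter> W) (\<lambda>q. ?h q + - 1 * ?k q)"
          by (intro smooth_fun_on_add smooth_fun_on_mult smooth_fun_on_const V h k)
        then have "smooth_at A p (\<lambda>q. ?h q + - 1 * ?k q)" by (rule smooth_atI[OF V])
        then show "smooth_at A p (\<lambda>q. lie_bracket A Y' Z' q f)"
          by (rule smooth_at_cong[OF V, THEN iffD1, rotated])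
            (use smooth_atI[OF V(1) _ f] in \<open>simp add: lie_bracket_def\<close>)
      qed
      finally show "X' p (\<lambda>q. lie_bracket A Y' Z' q f) = X' p ?h - X' p ?k" by simp
      have "smooth_at A p (\<lambda>q. X' q f)" by (rule smooth_atI[OF V D[OF X' V(1) f]])
      then show "lie_bracket A Y' Z' p (\<lambda>q. X' q f) =
        Y' p (\<lambda>q. Z' q (\<lambda>q. X' q f)) - Z' p (\<lambda>q. Y' q (\<lambda>q. X' q f))"
        by (simp add: lie_bracket_def)
    qed
    have "lie_bracket A X' (lie_bracket A Y' Z') p f =
        X' p (\<lambda>q. lie_bracket A Y' Z' q f) - lie_bracket A Y' Z' p (\<lambda>q. X' q f)" for X' Y' Z'
      using True unfolding lie_bracket_def[of A X' "lie_bracket A Y' Z'"] by simp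
    then show ?thesis
      using *[OF X Y Z] *[OF Y Z X] *[OF Z X Y] by simp
  qed (simp add: lie_bracket_def)
qed

end

section \<open>Second covariant derivative, curvature and Ricci operator\<close>

context pseudo_riemannian_manifold
begin

lemma tensorial_at_diff:
  assumes T: "tensorial_at U p T" and X: "smooth_vfield_on A U X" and Y: "smooth_vfield_on A U Y"
  shows "T (\<lambda>q. X q - Y q) = T X - T Y"
proof -
  have m: "smooth_vfield_on A U (\<lambda>q. (- 1) *\<^sub>R Y q)"
    by (intro smooth_vfield_on_scale smooth_fun_on_const Y)
  have "T (\<lambda>q. X q + (- 1) *\<^sub>R Y q) = T X + T (\<lambda>q. (- 1) *\<^sub>R Y q)"
    by (rule tensorial_at_add[OF T X m])
  also have "T (\<lambda>q. (- 1) *\<^sub>R Y q) = (- 1) *\<^sub>R T Y"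
    by (rule tensorial_at_scale[OF T smooth_fun_on_const Y])
  finally show ?thesis unfolding scaleR_minus1_left add_uminus_conv_diff .
qed

lemma tensorial_at_subtract:
  "tensorial_at U p S \<Longrightarrow> tensorial_at U p T \<Longrightarrow> tensorial_at U p (\<lambda>X. S X - T X)"
  unfolding tensorial_at_def by (simp add: scaleR_diff_right)

end

section \<open>Locality of the connection and tensoriality of its second derivatives\<close>

context levi_civita_connection
begin

lemma tensorial_nabla:
  assumes "open U" "p \<in> U" "smooth_vfield_on A U Y"
  shows "tensorial_at U p (\<lambda>X. nabla X Y p)"
  unfolding tensorial_at_def using assms nabla_add_left nabla_scale_left by simp

text \<open>Again by multiplication with the indicator of \<open>U\<close>: the extra term in the
  Leibniz rule vanishes because the indicator is constant near \<open>p\<close>.\<close>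

lemma nabla_cong_right:
  assumes U: "open U" "p \<in> U" and X: "smooth_vfield_on A U X"
    and Y: "smooth_vfield_on A U Y" and Y': "smooth_vfield_on A U Y'"
    and eq: "\<And>q. q \<in> U \<Longrightarrow> Y q = Y' q"
  shows "nabla X Y p = nabla X Y' p"
proof -
  let ?f = "indicator U :: 'm \<Rightarrow> real"
  have f: "smooth_fun_on A U ?f"
    by (rule smooth_fun_on_cong[OF U(1), THEN iffD1, OF _ smooth_fun_on_const[of U 1]]) simp
  have "X p ?f = 0"
    by (rule tangent_vector_const[OF smooth_vfield_onD(1)[OF X U(2)] U, of _ 1]) simp
  then have "nabla X (\<lambda>q. ?f q *\<^sub>R Z q) p = nabla X Z p" if "smooth_vfield_on A U Z" for Z
    using nabla_leibniz[OF U(1) f X that U(2)] U(2) by simp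
  moreover have "(\<lambda>q. ?f q *\<^sub>R Y q) = (\<lambda>q. ?f q *\<^sub>R Y' q)"
    using eq by (auto simp: fun_eq_iff indicator_def)
  ultimately show ?thesis using Y Y' by metis
qed

lemma nabla_diff_right:
  assumes U: "open U" "p \<in> U" and X: "smooth_vfield_on A U X"
    and Y: "smooth_vfield_on A U Y" and Z: "smooth_vfield_on A U Z"
  shows "nabla X (\<lambda>q. Y q - Z q) p = nabla X Y p - nabla X Z p"
proof -
  have m: "smooth_vfield_on A U (\<lambda>q. (- 1) *\<^sub>R Z q)"
    by (intro smooth_vfield_on_scale smooth_fun_on_const Z)
  have "X p (\<lambda>q. - 1) = 0"
    by (rule tangent_vector_const[OF smooth_vfield_onD(1)[OF X U(2)] U]) simp
  then have "nabla X (\<lambda>q. (- 1) *\<^sub>R Z q) p = - nabla X Z p"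
    unfolding nabla_leibniz[OF U(1) smooth_fun_on_const[of U "- 1"] X Z U(2)] by simp
  then show ?thesis
    using nabla_add_right[OF U(1) X Y m U(2)]
    unfolding scaleR_minus1_left add_uminus_conv_diff by simp
qed

text \<open>That the commutator is a first-order operator rests on the symmetry of second
  derivatives. Torsion-freeness supplies this at once, as it writes the bracket as a difference of
  two smooth vector fields.\<close>

lemma lie_bracket_smooth:
  assumes U: "open U" and X: "smooth_vfield_on A U X" and Y: "smooth_vfield_on A U Y"
  shows "smooth_vfield_on A U (lie_bracket A X Y)"
proof (rule smooth_vfield_on_cong[OF U, THEN iffD1])
  show "smooth_vfield_on A U (\<lambda>q. nabla X Y q - nabla Y X q)"
    by (intro smooth_vfield_on_diff nabla_smooth U X Y)
  show "nabla X Y q - nabla Y X q = lie_bracket A X Y q" if "q \<in> U" for q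
    by (rule nabla_torsion_free[OF U X Y that])
qed

text \<open>The second covariant derivative of \<open>Z\<close>. The correction term makes it
  tensorial in \<open>X\<close> and \<open>Y\<close>. Its metric trace is the rough Laplacian and
  its skew part is the curvature, so one component formula serves both sides of the theorem.\<close>

definition second_covariant :: "'m vfield \<Rightarrow> 'm vfield \<Rightarrow> 'm vfield \<Rightarrow> 'm vfield"
  where "second_covariant X Y Z p = nabla X (nabla Y Z) p - nabla (nabla X Y) Z p"

lemma tensorial_second_covariant_1:
  assumes U: "open U" "p \<in> U" and Y: "smooth_vfield_on A U Y" and Z: "smooth_vfield_on A U Z"
  shows "tensorial_at U p (\<lambda>X. second_covariant X Y Z p)"
proof -
  have "tensorial_at U p (\<lambda>X. nabla (nabla X Y) Z p)"
    unfolding tensorial_at_def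
  proof (intro conjI allI impI)
    fix X X' assume X: "smooth_vfield_on A U X" and X': "smooth_vfield_on A U X'"
    have "nabla (nabla (\<lambda>q. X q + X' q) Y) Z p = nabla (\<lambda>q. nabla X Y q + nabla X' Y q) Z p"
      by (rule tensorial_at_cong[OF tensorial_nabla[OF U Z] U])
        (intro nabla_smooth smooth_vfield_on_add U X X' Y nabla_add_left[OF U(1) X X' Y]; assumption)+
    also have "\<dots> = nabla (nabla X Y) Z p + nabla (nabla X' Y) Z p"
      by (intro nabla_add_left[OF U(1)] nabla_smooth U X X' Y Z)
    finally show "nabla (nabla (\<lambda>q. X q + X' q) Y) Z p = nabla (nabla X Y) Z p + nabla (nabla X' Y) Z p" .
  next
    fix f X assume f: "smooth_fun_on A U f" and X: "smooth_vfield_on A U X"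
    have "nabla (nabla (\<lambda>q. f q *\<^sub>R X q) Y) Z p = nabla (\<lambda>q. f q *\<^sub>R nabla X Y q) Z p"
      by (rule tensorial_at_cong[OF tensorial_nabla[OF U Z] U])
        (intro nabla_smooth smooth_vfield_on_scale U X f Y nabla_scale_left[OF U(1) f X Y]; assumption)+
    also have "\<dots> = f p *\<^sub>R nabla (nabla X Y) Z p"
      by (intro nabla_scale_left[OF U(1)] nabla_smooth U f X Y Z)
    finally show "nabla (nabla (\<lambda>q. f q *\<^sub>R X q) Y) Z p = f p *\<^sub>R nabla (nabla X Y) Z p" .
  qed
  then show ?thesis
    unfolding second_covariant_def
    by (intro tensorial_at_subtract tensorial_nabla U nabla_smooth Y Z)
qed

text \<open>The derivative of \<open>f\<close> along \<open>X\<close> occurs in both terms of the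
  definition, each time with the factor \<open>nabla Y Z p\<close>, and cancels.\<close>

lemma tensorial_second_covariant_2:
  assumes U: "open U" "p \<in> U" and X: "smooth_vfield_on A U X" and Z: "smooth_vfield_on A U Z"
  shows "tensorial_at U p (\<lambda>Y. second_covariant X Y Z p)"
  unfolding tensorial_at_def
proof (intro conjI allI impI)
  fix Y Y' assume Y: "smooth_vfield_on A U Y" and Y': "smooth_vfield_on A U Y'"
  have "nabla X (nabla (\<lambda>q. Y q + Y' q) Z) p = nabla X (\<lambda>q. nabla Y Z q + nabla Y' Z q) p"
    by (rule nabla_cong_right[OF U X])
      (intro nabla_smooth smooth_vfield_on_add U Y Y' Z nabla_add_left[OF U(1) Y Y' Z]; assumption)+
  also have "\<dots> = nabla X (nabla Y Z) p + nabla X (nabla Y' Z) p"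
    by (intro nabla_add_right[OF U(1)] nabla_smooth U X Y Y' Z)
  finally have 1: "nabla X (nabla (\<lambda>q. Y q + Y' q) Z) p = nabla X (nabla Y Z) p + nabla X (nabla Y' Z) p" .
  have "nabla (nabla X (\<lambda>q. Y q + Y' q)) Z p = nabla (\<lambda>q. nabla X Y q + nabla X Y' q) Z p"
    by (rule tensorial_at_cong[OF tensorial_nabla[OF U Z] U])
      (intro nabla_smooth smooth_vfield_on_add U X Y Y' nabla_add_right[OF U(1) X Y Y']; assumption)+
  also have "\<dots> = nabla (nabla X Y) Z p + nabla (nabla X Y') Z p"
    by (intro nabla_add_left[OF U(1)] nabla_smooth U X Y Y' Z)
  finally show "second_covariant X (\<lambda>q. Y q + Y' q) Z p = second_covariant X Y Z p + second_covariant X Y' Z p"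
    unfolding second_covariant_def using 1 by simp
next
  fix f Y assume f: "smooth_fun_on A U f" and Y: "smooth_vfield_on A U Y"
  have Xf: "smooth_fun_on A U (\<lambda>q. X q f)" by (rule smooth_vfield_onD(2)[OF X U(1) f])
  have "nabla X (nabla (\<lambda>q. f q *\<^sub>R Y q) Z) p = nabla X (\<lambda>q. f q *\<^sub>R nabla Y Z q) p"
    by (rule nabla_cong_right[OF U X])
      (intro nabla_smooth smooth_vfield_on_scale U f Y Z nabla_scale_left[OF U(1) f Y Z]; assumption)+
  also have "\<dots> = X p f *\<^sub>R nabla Y Z p + f p *\<^sub>R nabla X (nabla Y Z) p"
    by (intro nabla_leibniz[OF U(1)] nabla_smooth U f X Y Z)
  finally have 1: "nabla X (nabla (\<lambda>q. f q *\<^sub>R Y q) Z) p =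
    X p f *\<^sub>R nabla Y Z p + f p *\<^sub>R nabla X (nabla Y Z) p" .
  have a: "smooth_vfield_on A U (\<lambda>q. X q f *\<^sub>R Y q)" and b: "smooth_vfield_on A U (\<lambda>q. f q *\<^sub>R nabla X Y q)"
    by (intro smooth_vfield_on_scale nabla_smooth U f Xf X Y)+
  have "nabla (nabla X (\<lambda>q. f q *\<^sub>R Y q)) Z p = nabla (\<lambda>q. X q f *\<^sub>R Y q + f q *\<^sub>R nabla X Y q) Z p"
    by (rule tensorial_at_cong[OF tensorial_nabla[OF U Z] U])
      (intro nabla_smooth smooth_vfield_on_add smooth_vfield_on_scale U f X Y a b
        nabla_leibniz[OF U(1) f X Y]; assumption)+
  also have "\<dots> = nabla (\<lambda>q. X q f *\<^sub>R Y q) Z p + nabla (\<lambda>q. f q *\<^sub>R nabla X Y q) Z p"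
    by (intro nabla_add_left[OF U(1)] a b U Z)
  also have "\<dots> = X p f *\<^sub>R nabla Y Z p + f p *\<^sub>R nabla (nabla X Y) Z p"
    by (intro arg_cong2[of _ _ _ _ "(+)"] nabla_scale_left[OF U(1)] nabla_smooth U f Xf X Y Z)
  finally show "second_covariant X (\<lambda>q. f q *\<^sub>R Y q) Z p = f p *\<^sub>R second_covariant X Y Z p"
    unfolding second_covariant_def using 1 by (simp add: scaleR_diff_right)
qed

lemma curvature_eq_second_covariant:
  assumes U: "open U" "p \<in> U" and X: "smooth_vfield_on A U X"
    and Y: "smooth_vfield_on A U Y" and Z: "smooth_vfield_on A U Z"
  shows "curvature A nabla X Y Z p = second_covariant X Y Z p - second_covariant Y X Z p"
proof -
  have "nabla (lie_bracket A X Y) Z p = nabla (\<lambda>q. nabla X Y q - nabla Y X q) Z p"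
    by (rule tensorial_at_cong[OF tensorial_nabla[OF U Z] U])
      (intro lie_bracket_smooth smooth_vfield_on_diff nabla_smooth U X Y
        nabla_torsion_free[OF U(1) X Y, symmetric]; assumption)+
  also have "\<dots> = nabla (nabla X Y) Z p - nabla (nabla Y X) Z p"
    by (intro tensorial_at_diff[OF tensorial_nabla[OF U Z]] nabla_smooth U X Y)
  finally show ?thesis unfolding curvature_def second_covariant_def by simp
qed

lemma nabla_nabla_scale:
  assumes U: "open U" "p \<in> U" and X: "smooth_vfield_on A U X"
    and Y: "smooth_vfield_on A U Y" and Z: "smooth_vfield_on A U Z" and f: "smooth_fun_on A U f"
  shows "nabla X (nabla Y (\<lambda>q. f q *\<^sub>R Z q)) p = X p (\<lambda>q. Y q f) *\<^sub>R Z p + Y p f *\<^sub>R nabla X Z p +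
    (X p f *\<^sub>R nabla Y Z p + f p *\<^sub>R nabla X (nabla Y Z) p)"
proof -
  have Yf: "smooth_fun_on A U (\<lambda>q. Y q f)" by (rule smooth_vfield_onD(2)[OF Y U(1) f])
  have a: "smooth_vfield_on A U (\<lambda>q. Y q f *\<^sub>R Z q)" and b: "smooth_vfield_on A U (\<lambda>q. f q *\<^sub>R nabla Y Z q)"
    by (intro smooth_vfield_on_scale nabla_smooth U f Yf Y Z)+
  have "nabla X (nabla Y (\<lambda>q. f q *\<^sub>R Z q)) p = nabla X (\<lambda>q. Y q f *\<^sub>R Z q + f q *\<^sub>R nabla Y Z q) p"
    by (rule nabla_cong_right[OF U X])
      (intro nabla_smooth smooth_vfield_on_add smooth_vfield_on_scale U f Y Z a b
        nabla_leibniz[OF U(1) f Y Z]; assumption)+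
  also have "\<dots> = nabla X (\<lambda>q. Y q f *\<^sub>R Z q) p + nabla X (\<lambda>q. f q *\<^sub>R nabla Y Z q) p"
    by (intro nabla_add_right[OF U(1)] a b U X)
  also have "\<dots> = X p (\<lambda>q. Y q f) *\<^sub>R Z p + Y p f *\<^sub>R nabla X Z p +
      (X p f *\<^sub>R nabla Y Z p + f p *\<^sub>R nabla X (nabla Y Z) p)"
    by (intro arg_cong2[of _ _ _ _ "(+)"] nabla_leibniz[OF U(1)] nabla_smooth U f Yf X Y Z)
  finally show ?thesis .
qed

text \<open>For a product with \<open>f\<close>, the mixed first-order terms are symmetric in
  \<open>X\<close> and \<open>Y\<close> and cancel. The second-order terms leave the commutator
  applied to \<open>f\<close>, which the bracket term removes.\<close>

lemma tensorial_curvature_3: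
  assumes U: "open U" "p \<in> U" and X: "smooth_vfield_on A U X" and Y: "smooth_vfield_on A U Y"
  shows "tensorial_at U p (\<lambda>Z. curvature A nabla X Y Z p)"
  unfolding tensorial_at_def
proof (intro conjI allI impI)
  have B: "smooth_vfield_on A U (lie_bracket A X Y)" by (rule lie_bracket_smooth[OF U(1) X Y])
  {
    fix Z Z' assume Z: "smooth_vfield_on A U Z" and Z': "smooth_vfield_on A U Z'"
    have *: "nabla X' (nabla Y' (\<lambda>q. Z q + Z' q)) p = nabla X' (nabla Y' Z) p + nabla X' (nabla Y' Z') p"
      if X': "smooth_vfield_on A U X'" and Y': "smooth_vfield_on A U Y'" for X' Y'
    proof -
      have "nabla X' (nabla Y' (\<lambda>q. Z q + Z' q)) p = nabla X' (\<lambda>q. nabla Y' Z q + nabla Y' Z' q) p"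
        by (rule nabla_cong_right[OF U X'])
          (intro nabla_smooth smooth_vfield_on_add U Y' Z Z' nabla_add_right[OF U(1) Y' Z Z']; assumption)+
      also have "\<dots> = nabla X' (nabla Y' Z) p + nabla X' (nabla Y' Z') p"
        by (intro nabla_add_right[OF U(1)] nabla_smooth U X' Y' Z Z')
      finally show ?thesis .
    qed
    show "curvature A nabla X Y (\<lambda>q. Z q + Z' q) p =
        curvature A nabla X Y Z p + curvature A nabla X Y Z' p"
      unfolding curvature_def *[OF X Y] *[OF Y X] nabla_add_right[OF U(1) B Z Z' U(2)] by simp
  next
    fix f Z assume f: "smooth_fun_on A U f" and Z: "smooth_vfield_on A U Z"
    have *: "lie_bracket A X Y p f = X p (\<lambda>q. Y q f) - Y p (\<lambda>q. X q f)"
      using smooth_atI[OF U f] by (simp add: lie_bracket_def)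
    show "curvature A nabla X Y (\<lambda>q. f q *\<^sub>R Z q) p = f p *\<^sub>R curvature A nabla X Y Z p"
      unfolding curvature_def nabla_nabla_scale[OF U X Y Z f] nabla_nabla_scale[OF U Y X Z f]
        nabla_leibniz[OF U(1) f B Z U(2)] *
      by (simp add: algebra_simps)
  }
qed

section \<open>Evaluation of rough Laplacian, curvature and Ricci operator in a frame\<close>

lemma nabla_tangent:
  "open U \<Longrightarrow> p \<in> U \<Longrightarrow> smooth_vfield_on A U X \<Longrightarrow> smooth_vfield_on A U Y \<Longrightarrow>
    nabla X Y p \<in> tangent_space A p"
  by (rule smooth_vfield_onD(1)[OF nabla_smooth])

lemma second_covariant_tangent:
  assumes "open U" "p \<in> U" "smooth_vfield_on A U X" "smooth_vfield_on A U Y" "smooth_vfield_on A U Z"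
  shows "second_covariant X Y Z p \<in> tangent_space A p"
  unfolding second_covariant_def
  by (intro subspace_diff[OF subspace_tangent_space] nabla_tangent[OF assms(1,2)] nabla_smooth assms)

lemma curvature_tangent:
  assumes "open U" "p \<in> U" "smooth_vfield_on A U X" "smooth_vfield_on A U Y" "smooth_vfield_on A U Z"
  shows "curvature A nabla X Y Z p \<in> tangent_space A p"
  unfolding curvature_eq_second_covariant[OF assms]
  by (intro subspace_diff[OF subspace_tangent_space] second_covariant_tangent[of U] assms)

lemma second_covariant_expansion:
  assumes U: "open U" "p \<in> U" and e: "pseudo_orthonormal_frame_on A g U e \<epsilon>"
    and X: "smooth_vfield_on A U X" and Y: "smooth_vfield_on A U Y" and Z: "smooth_vfield_on A U Z"
  shows "second_covariant X Y Z p = (\<Sum>j\<in>UNIV. \<Sum>k\<in>UNIV.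
    (\<epsilon> j * g p (X p) (e j p) * (\<epsilon> k * g p (Y p) (e k p))) *\<^sub>R second_covariant (e j) (e k) Z p)"
proof -
  note e' = frame_smooth[OF e]
  have "second_covariant X Y Z p =
      (\<Sum>j\<in>UNIV. (\<epsilon> j * g p (X p) (e j p)) *\<^sub>R second_covariant (e j) Y Z p)"
    by (rule tensorial_at_expansion[OF tensorial_second_covariant_1[OF U Y Z] U e X])
  also have "\<dots> = (\<Sum>j\<in>UNIV. (\<epsilon> j * g p (X p) (e j p)) *\<^sub>R
      (\<Sum>k\<in>UNIV. (\<epsilon> k * g p (Y p) (e k p)) *\<^sub>R second_covariant (e j) (e k) Z p))"
    by (intro sum.cong refl arg_cong2[of _ _ _ _ scaleR]
        tensorial_at_expansion[OF tensorial_second_covariant_2[OF U e' Z] U e Y])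
  finally show ?thesis by (simp only: scaleR_sum_right scaleR_scaleR)
qed

text \<open>The description ranges over frames on arbitrary neighbourhoods. On the intersection of
  two domains, tensoriality reduces the second covariant derivative to a bilinear map on the tangent
  space at \<open>p\<close>, and \<open>orthonormal_trace_unique\<close> applies.\<close>

lemma rough_laplacian_frame:
  assumes U: "open U" "p \<in> U" and e: "pseudo_orthonormal_frame_on A g U e \<epsilon>"
    and V: "smooth_vfield_on A U V"
  shows "rough_laplacian A g nabla V p = (\<Sum>i\<in>UNIV. \<epsilon> i *\<^sub>R second_covariant (e i) (e i) V p)"
proof -
  have *: "(\<Sum>i\<in>UNIV. \<delta> i *\<^sub>R second_covariant (f i) (f i) V p) =
      (\<Sum>i\<in>UNIV. \<epsilon> i *\<^sub>R second_covariant (e i) (e i) V p)"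
    if W: "open W" "p \<in> W" and f: "pseudo_orthonormal_frame_on A g W f \<delta>" for W f \<delta>
  proof -
    have UW: "open (U \<inter> W)" "p \<in> U \<inter> W" using U W by auto
    have e': "pseudo_orthonormal_frame_on A g (U \<inter> W) e \<epsilon>"
      and f': "pseudo_orthonormal_frame_on A g (U \<inter> W) f \<delta>"
      using frame_subset[OF e, of "U \<inter> W"] frame_subset[OF f, of "U \<inter> W"] by simp_all
    have V': "smooth_vfield_on A (U \<inter> W) V" using smooth_vfield_on_subset[OF V] by simp
    let ?T = "\<lambda>u v. \<Sum>j\<in>UNIV. \<Sum>k\<in>UNIV.
      (\<epsilon> j * g p u (e j p) * (\<epsilon> k * g p v (e k p))) *\<^sub>R second_covariant (e j) (e k) V p"
    have "second_covariant (f i) (f i) V p = ?T (f i p) (f i p)" for i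
      by (rule second_covariant_expansion[OF UW e' frame_smooth[OF f'] frame_smooth[OF f'] V'])
    then show ?thesis
      using orthonormal_trace_unique[OF frame_orthonormal_at[OF e U(2)]
          frame_orthonormal_at[OF f W(2)], of ?T "\<lambda>j k. second_covariant (e j) (e k) V p"]
      by simp
  qed
  show ?thesis
    unfolding rough_laplacian_def second_covariant_def[symmetric]
  proof (rule the_equality)
    show "\<exists>W f \<delta>. open W \<and> p \<in> W \<and> pseudo_orthonormal_frame_on A g W f \<delta> \<and>
        (\<Sum>i\<in>UNIV. \<epsilon> i *\<^sub>R second_covariant (e i) (e i) V p) =
        (\<Sum>i\<in>UNIV. \<delta> i *\<^sub>R second_covariant (f i) (f i) V p)"
      by (intro exI[of _ U] exI[of _ e] exI[of _ \<epsilon>] conjI U e refl)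
  qed (elim exE conjE, use * in simp)
qed

definition frame_curvature :: "('d \<Rightarrow> 'm vfield) \<Rightarrow> 'm \<Rightarrow> 'd \<Rightarrow> 'd \<Rightarrow> 'd \<Rightarrow> 'm tvec"
  where "frame_curvature e p i j k = curvature A nabla (e i) (e j) (e k) p"

lemma curvature_expansion:
  assumes U: "open U" "p \<in> U" and e: "pseudo_orthonormal_frame_on A g U e \<epsilon>"
    and X: "smooth_vfield_on A U X" and Y: "smooth_vfield_on A U Y" and Z: "smooth_vfield_on A U Z"
  shows "curvature A nabla X Y Z p =
    (\<Sum>i\<in>UNIV. (\<epsilon> i * g p (X p) (e i p)) *\<^sub>R (\<Sum>j\<in>UNIV. (\<epsilon> j * g p (Y p) (e j p)) *\<^sub>R
      (\<Sum>k\<in>UNIV. (\<epsilon> k * g p (Z p) (e k p)) *\<^sub>R frame_curvature e p i j k)))"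
proof -
  note e' = frame_smooth[OF e]
  let ?R = "\<lambda>X Y. second_covariant X Y Z p - second_covariant Y X Z p"
  have "?R X Y = (\<Sum>i\<in>UNIV. (\<epsilon> i * g p (X p) (e i p)) *\<^sub>R ?R (e i) Y)"
    by (rule tensorial_at_expansion[OF _ U e X])
      (intro tensorial_at_subtract tensorial_second_covariant_1 tensorial_second_covariant_2 U Y Z)
  also have "\<dots> = (\<Sum>i\<in>UNIV. (\<epsilon> i * g p (X p) (e i p)) *\<^sub>R
      (\<Sum>j\<in>UNIV. (\<epsilon> j * g p (Y p) (e j p)) *\<^sub>R ?R (e i) (e j)))"
    by (intro sum.cong refl arg_cong2[of _ _ _ _ scaleR] tensorial_at_expansion[OF _ U e Y]
        tensorial_at_subtract tensorial_second_covariant_1 tensorial_second_covariant_2 U Z e')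
  also have "\<dots> = (\<Sum>i\<in>UNIV. (\<epsilon> i * g p (X p) (e i p)) *\<^sub>R (\<Sum>j\<in>UNIV. (\<epsilon> j * g p (Y p) (e j p)) *\<^sub>R
      (\<Sum>k\<in>UNIV. (\<epsilon> k * g p (Z p) (e k p)) *\<^sub>R frame_curvature e p i j k)))"
    unfolding curvature_eq_second_covariant[OF U e' e' Z, symmetric] frame_curvature_def
    by (intro sum.cong refl arg_cong2[of _ _ _ _ scaleR]
        tensorial_at_expansion[OF tensorial_curvature_3[OF U e' e'] U e Z])
  finally show ?thesis unfolding curvature_eq_second_covariant[OF U X Y Z] .
qed

text \<open>The right-hand side involves only the three vectors at \<open>p\<close>, so every choice
  of extensions leads to it, and constant extensions show that a choice exists. The formula also
  exhibits the linearity in each argument.\<close>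

lemma curvature_at_frame:
  assumes U: "open U" "p \<in> U" and e: "pseudo_orthonormal_frame_on A g U e \<epsilon>"
    and u: "u \<in> tangent_space A p" and v: "v \<in> tangent_space A p" and w: "w \<in> tangent_space A p"
  shows "curvature_at A nabla p u v w =
    (\<Sum>i\<in>UNIV. (\<epsilon> i * g p u (e i p)) *\<^sub>R (\<Sum>j\<in>UNIV. (\<epsilon> j * g p v (e j p)) *\<^sub>R
      (\<Sum>k\<in>UNIV. (\<epsilon> k * g p w (e k p)) *\<^sub>R frame_curvature e p i j k)))" (is "_ = ?r")
  unfolding curvature_at_def
proof (rule the_equality)
  obtain X where X: "smooth_vfield_on A U X" "X p = u" using constant_extension[OF U e u] .
  obtain Y where Y: "smooth_vfield_on A U Y" "Y p = v" using constant_extension[OF U e v] .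
  obtain Z where Z: "smooth_vfield_on A U Z" "Z p = w" using constant_extension[OF U e w] .
  have "?r = curvature A nabla X Y Z p"
    using curvature_expansion[OF U e X(1) Y(1) Z(1)] unfolding X(2) Y(2) Z(2) by (rule sym)
  then show "\<exists>U X Y Z. open U \<and> p \<in> U \<and> smooth_vfield_on A U X \<and> smooth_vfield_on A U Y \<and>
      smooth_vfield_on A U Z \<and> X p = u \<and> Y p = v \<and> Z p = w \<and> ?r = curvature A nabla X Y Z p"
    by (intro exI[of _ U] exI[of _ X] exI[of _ Y] exI[of _ Z] conjI U X Y Z)
next
  fix r
  assume "\<exists>U X Y Z. open U \<and> p \<in> U \<and> smooth_vfield_on A U X \<and> smooth_vfield_on A U Y \<and>
      smooth_vfield_on A U Z \<and> X p = u \<and> Y p = v \<and> Z p = w \<and> r = curvature A nabla X Y Z p"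
  then obtain W X Y Z where W: "open W" "p \<in> W" and X: "smooth_vfield_on A W X" "X p = u"
    and Y: "smooth_vfield_on A W Y" "Y p = v" and Z: "smooth_vfield_on A W Z" "Z p = w"
    and r: "r = curvature A nabla X Y Z p"
    by (elim exE conjE)
  have UW: "open (U \<inter> W)" "p \<in> U \<inter> W" "U \<inter> W \<subseteq> U" "U \<inter> W \<subseteq> W" using U W by auto
  show "r = ?r"
    using curvature_expansion[OF UW(1,2) frame_subset[OF e UW(3)] smooth_vfield_on_subset[OF X(1) UW(4)]
        smooth_vfield_on_subset[OF Y(1) UW(4)] smooth_vfield_on_subset[OF Z(1) UW(4)]]
    unfolding r X(2) Y(2) Z(2) .
qed

lemma
  assumes U: "open U" "p \<in> U" and e: "pseudo_orthonormal_frame_on A g U e \<epsilon>"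
    and u: "u \<in> tangent_space A p" and v: "v \<in> tangent_space A p"
  shows linear_curvature_at_1: "linear_on (tangent_space A p) (\<lambda>w. curvature_at A nabla p w u v)"
    and linear_curvature_at_3: "linear_on (tangent_space A p) (\<lambda>w. curvature_at A nabla p u v w)"
    and curvature_at_tangent:
      "w \<in> tangent_space A p \<Longrightarrow> curvature_at A nabla p u v w \<in> tangent_space A p"
proof -
  note e' = smooth_vfield_onD(1)[OF frame_smooth[OF e] U(2)]
  have T: "x + y \<in> tangent_space A p" "r *\<^sub>R x \<in> tangent_space A p"
    if "x \<in> tangent_space A p" "y \<in> tangent_space A p" for x y r
    using that by (auto intro: subspace_add subspace_scale subspace_tangent_space)
  show "linear_on (tangent_space A p) (\<lambda>w. curvature_at A nabla p w u v)"
    unfolding linear_on_def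
    using u v T e'
    by (simp add: curvature_at_frame[OF U e] metric_add_left metric_scale_left distrib_left
        scaleR_add_left scaleR_add_right sum.distrib scaleR_sum_right mult_ac)
  show "linear_on (tangent_space A p) (\<lambda>w. curvature_at A nabla p u v w)"
    unfolding linear_on_def
    using u v T e'
    by (simp add: curvature_at_frame[OF U e] metric_add_left metric_scale_left distrib_left
        scaleR_add_left scaleR_add_right sum.distrib scaleR_sum_right mult_ac)
  show "curvature_at A nabla p u v w \<in> tangent_space A p" if "w \<in> tangent_space A p"
    unfolding curvature_at_frame[OF U e u v that] frame_curvature_def
    by (intro tangent_sum curvature_tangent[OF U] frame_smooth[OF e])
qed

lemma curvature_at_eq:
  assumes "open U" "p \<in> U" "pseudo_orthonormal_frame_on A g U e \<epsilon>"
    and "smooth_vfield_on A U X" "smooth_vfield_on A U Y" "smooth_vfield_on A U Z"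
  shows "curvature_at A nabla p (X p) (Y p) (Z p) = curvature A nabla X Y Z p"
  unfolding curvature_expansion[OF assms]
  by (intro curvature_at_frame[OF assms(1-3)] smooth_vfield_onD(1)[OF _ assms(2)] assms(4-6))

lemma ricci_tensor_frame:
  assumes U: "open U" "p \<in> U" and e: "pseudo_orthonormal_frame_on A g U e \<epsilon>"
    and u: "u \<in> tangent_space A p" and v: "v \<in> tangent_space A p"
  shows "ricci_tensor A nabla p u v =
    (\<Sum>i\<in>UNIV. \<epsilon> i * g p (curvature_at A nabla p (e i p) u v) (e i p))"
  unfolding ricci_tensor_def
proof (rule trace_on_tangent_space[OF frame_orthonormal_at[OF e U(2)]])
  show "linear_on (tangent_space A p) (\<lambda>w. curvature_at A nabla p w u v)"
    by (rule linear_curvature_at_1[OF U e u v])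
  show "(\<lambda>w. curvature_at A nabla p w u v) ` tangent_space A p \<subseteq> tangent_space A p"
    by (intro image_subsetI curvature_at_tangent[OF U e] u v)
qed

lemma linear_ricci_tensor:
  assumes U: "open U" "p \<in> U" and e: "pseudo_orthonormal_frame_on A g U e \<epsilon>"
    and u: "u \<in> tangent_space A p"
  shows "linear_on (tangent_space A p) (ricci_tensor A nabla p u)"
proof -
  note e' = smooth_vfield_onD(1)[OF frame_smooth[OF e] U(2)]
  have T: "x + y \<in> tangent_space A p" "r *\<^sub>R x \<in> tangent_space A p"
    if "x \<in> tangent_space A p" "y \<in> tangent_space A p" for x y r
    using that by (auto intro: subspace_add subspace_scale subspace_tangent_space)
  have add: "curvature_at A nabla p (e i p) u (x + y) =
      curvature_at A nabla p (e i p) u x + curvature_at A nabla p (e i p) u y"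
    and scale: "curvature_at A nabla p (e i p) u (r *\<^sub>R x) = r *\<^sub>R curvature_at A nabla p (e i p) u x"
    if "x \<in> tangent_space A p" "y \<in> tangent_space A p" for i x y r
    using linear_curvature_at_3[OF U e e' u] that unfolding linear_on_def by simp_all
  show ?thesis
    unfolding linear_on_def
    using u T e' curvature_at_tangent[OF U e]
    by (simp add: ricci_tensor_frame[OF U e] add scale metric_add_left metric_scale_left distrib_left
        sum.distrib sum_distrib_left mult_ac)
qed

text \<open>A representing vector has the coefficients \<epsilon>_k Ric(u, e_k) in the frame. It is
  unique because the metric is nondegenerate, so the definite description is meaningful.\<close>

lemma ricci_operator_characterization:
  assumes U: "open U" "p \<in> U" and e: "pseudo_orthonormal_frame_on A g U e \<epsilon>"
    and u: "u \<in> tangent_space A p"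
  shows "ricci_operator A g nabla p u \<in> tangent_space A p \<and>
    (\<forall>v\<in>tangent_space A p. g p (ricci_operator A g nabla p u) v = ricci_tensor A nabla p u v)"
  unfolding ricci_operator_def
proof (rule theI'[of "\<lambda>q. q \<in> tangent_space A p \<and>
      (\<forall>v\<in>tangent_space A p. g p q v = ricci_tensor A nabla p u v)"], rule ex_ex1I)
  note e' = smooth_vfield_onD(1)[OF frame_smooth[OF e] U(2)]
  let ?q = "\<Sum>k\<in>UNIV. (\<epsilon> k * ricci_tensor A nabla p u (e k p)) *\<^sub>R e k p"
  have "g p ?q v = ricci_tensor A nabla p u v" if v: "v \<in> tangent_space A p" for v
  proof -
    have "ricci_tensor A nabla p u v =
        ricci_tensor A nabla p u (\<Sum>k\<in>UNIV. (\<epsilon> k * g p v (e k p)) *\<^sub>R e k p)"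
      using frame_expansion[OF e U(2) v] by simp
    also have "\<dots> = (\<Sum>k\<in>UNIV. (\<epsilon> k * g p v (e k p)) *\<^sub>R ricci_tensor A nabla p u (e k p))"
      by (rule linear_on_sum[OF subspace_tangent_space linear_ricci_tensor[OF U e u] e'])
    also have "\<dots> = g p ?q v"
      using metric_sum_left[OF v, of UNIV "\<lambda>k. e k p"] e' metric_sym[OF v e']
      by (simp add: mult_ac)
    finally show ?thesis by simp
  qed
  then show "\<exists>q. q \<in> tangent_space A p \<and>
      (\<forall>v\<in>tangent_space A p. g p q v = ricci_tensor A nabla p u v)"
    using tangent_sum[of UNIV "\<lambda>k. e k p" p] e' by (intro exI[of _ ?q]) simp
  fix q r
  assume q: "q \<in> tangent_space A p \<and> (\<forall>v\<in>tangent_space A p. g p q v = ricci_tensor A nabla p u v)"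
    and r: "r \<in> tangent_space A p \<and> (\<forall>v\<in>tangent_space A p. g p r v = ricci_tensor A nabla p u v)"
  have "q - r = 0"
  proof (rule metric_nondegenerate)
    show "q - r \<in> tangent_space A p"
      using q r by (intro subspace_diff subspace_tangent_space) auto
    show "g p (q - r) v = 0" if "v \<in> tangent_space A p" for v
      using q r that metric_diff_left by simp
  qed
  then show "q = r" by simp
qed

end

section \<open>Connection coefficients\<close>

text \<open>This lemma and the next serve to differentiate the linear relations between connection
  coefficients along frame vectors.\<close>

lemma (in smooth_manifold) tangent_vector_sum_const:
  assumes v: "v \<in> tangent_space A p" and U: "open U" "p \<in> U"
    and f: "smooth_fun_on A U f" and h: "smooth_fun_on A U h"
    and eq: "\<And>q. q \<in> U \<Longrightarrow> f q + h q = r"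
  shows "v f + v h = 0"
  using tangent_vector_add[OF v smooth_atI[OF U f] smooth_atI[OF U h]]
    tangent_vector_const[OF v U, of "\<lambda>q. f q + h q" r] eq by simp

lemma (in smooth_manifold) tangent_vector_diff_const:
  assumes v: "v \<in> tangent_space A p" and U: "open U" "p \<in> U" and h: "smooth_fun_on A U h"
    and eq: "\<And>q. q \<in> U \<Longrightarrow> f q = h q + r"
  shows "v f = v h"
proof -
  have "v f = v (\<lambda>q. h q + r)" by (rule tangent_vector_cong[OF v U eq])
  also have "\<dots> = v h + v (\<lambda>q. r)"
    by (rule tangent_vector_add[OF v smooth_atI[OF U h] smooth_atI[OF U smooth_fun_on_const]])
  also have "v (\<lambda>q. r) = 0" by (rule tangent_vector_const[OF v U, of _ r]) simp
  finally show ?thesis by simp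
qed

context levi_civita_connection
begin

text \<open>The first Bianchi identity with its terms regrouped. Torsion-freeness expands each
  double bracket of the Jacobi identity into iterated covariant derivatives, and these form second
  covariant derivatives after a cyclic rearrangement.\<close>

lemma second_covariant_bianchi:
  assumes U: "open U" "p \<in> U" and X: "smooth_vfield_on A U X"
    and Y: "smooth_vfield_on A U Y" and Z: "smooth_vfield_on A U Z"
  shows "second_covariant X Y Z p - second_covariant X Z Y p +
    (second_covariant Y Z X p - second_covariant Y X Z p) +
    (second_covariant Z X Y p - second_covariant Z Y X p) = 0"
proof -
  have *: "lie_bracket A X (lie_bracket A Y Z) p = nabla X (nabla Y Z) p - nabla X (nabla Z Y) p -
      (nabla (nabla Y Z) X p - nabla (nabla Z Y) X p)"
    if X: "smooth_vfield_on A U X" and Y: "smooth_vfield_on A U Y" and Z: "smooth_vfield_on A U Z"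
    for X Y Z
  proof -
    have L: "smooth_vfield_on A U (lie_bracket A Y Z)" by (rule lie_bracket_smooth[OF U(1) Y Z])
    have D: "smooth_vfield_on A U (\<lambda>q. nabla Y Z q - nabla Z Y q)"
      by (intro smooth_vfield_on_diff nabla_smooth U Y Z)
    have eq: "lie_bracket A Y Z q = nabla Y Z q - nabla Z Y q" if "q \<in> U" for q
      by (rule nabla_torsion_free[OF U(1) Y Z that, symmetric])
    have "nabla X (lie_bracket A Y Z) p = nabla X (\<lambda>q. nabla Y Z q - nabla Z Y q) p"
      by (rule nabla_cong_right[OF U X L D eq])
    moreover have "nabla X (\<lambda>q. nabla Y Z q - nabla Z Y q) p = nabla X (nabla Y Z) p - nabla X (nabla Z Y) p"
      by (intro nabla_diff_right[OF U X] nabla_smooth U Y Z)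
    moreover have "nabla (lie_bracket A Y Z) X p = nabla (\<lambda>q. nabla Y Z q - nabla Z Y q) X p"
      by (rule tensorial_at_cong[OF tensorial_nabla[OF U X] U L D eq])
    moreover have "nabla (\<lambda>q. nabla Y Z q - nabla Z Y q) X p = nabla (nabla Y Z) X p - nabla (nabla Z Y) X p"
      by (intro tensorial_at_diff[OF tensorial_nabla[OF U X]] nabla_smooth U Y Z)
    ultimately show ?thesis
      using nabla_torsion_free[OF U(1) X L U(2)] by (simp only:)
  qed
  show ?thesis
    using jacobi_identity[OF U X Y Z]
    unfolding *[OF X Y Z] *[OF Y Z X] *[OF Z X Y] second_covariant_def
    by (simp add: algebra_simps)
qed

definition connection_coeff :: "('d \<Rightarrow> 'm vfield) \<Rightarrow> 'd \<Rightarrow> 'd \<Rightarrow> 'd \<Rightarrow> 'm \<Rightarrow> real"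
  where "connection_coeff e i j k q = g q (nabla (e i) (e j) q) (e k q)"

lemma connection_coeff_smooth:
  assumes "open U" "pseudo_orthonormal_frame_on A g U e \<epsilon>"
  shows "smooth_fun_on A U (connection_coeff e i j k)"
  unfolding connection_coeff_def
  by (intro metric_smooth nabla_smooth assms(1) frame_smooth[OF assms(2)])

lemma connection_coeff_skew:
  assumes U: "open U" "q \<in> U" and e: "pseudo_orthonormal_frame_on A g U e \<epsilon>"
  shows "connection_coeff e i j k q = - connection_coeff e i k j q"
proof -
  note e' = frame_smooth[OF e]
  have eT: "e i q \<in> tangent_space A q" for i by (rule smooth_vfield_onD(1)[OF e' U(2)])
  have "e i q (\<lambda>q. g q (e j q) (e k q)) = 0"
    by (rule tangent_vector_const[OF eT U, of _ "if j = k then \<epsilon> j else 0"])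
      (use e in \<open>simp add: pseudo_orthonormal_frame_on_def\<close>)
  then show ?thesis
    using nabla_metric[OF U(1) e' e' e' U(2), of i j k]
      metric_sym[OF eT nabla_tangent[OF U e' e'], of j i k]
    unfolding connection_coeff_def by simp
qed

text \<open>Metric compatibility, applied to the derivative of the coefficient along
  \<open>e l\<close>, yields the iterated derivative and the first sum. The second sum is the
  correction term, expanded by tensoriality in the lower argument.\<close>

lemma second_covariant_coeff:
  assumes U: "open U" "p \<in> U" and e: "pseudo_orthonormal_frame_on A g U e \<epsilon>"
  shows "g p (second_covariant (e l) (e i) (e j) p) (e k p) =
    e l p (connection_coeff e i j k) -
    (\<Sum>m\<in>UNIV. \<epsilon> m * connection_coeff e i j m p * connection_coeff e l k m p) -
    (\<Sum>m\<in>UNIV. \<epsilon> m * connection_coeff e l i m p * connection_coeff e m j k p)"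
proof -
  note e' = frame_smooth[OF e]
  have eT: "e i p \<in> tangent_space A p" for i by (rule smooth_vfield_onD(1)[OF e' U(2)])
  have nT: "nabla (e i) (e j) p \<in> tangent_space A p" for i j by (rule nabla_tangent[OF U e' e'])
  have nn: "smooth_vfield_on A U (nabla (e i) (e j))" for i j by (rule nabla_smooth[OF U(1) e' e'])
  have "e l p (connection_coeff e i j k) =
      g p (nabla (e l) (nabla (e i) (e j)) p) (e k p) + g p (nabla (e i) (e j) p) (nabla (e l) (e k) p)"
    using nabla_metric[OF U(1) e' nn e' U(2), of l i j k] unfolding connection_coeff_def .
  moreover have "g p (nabla (e i) (e j) p) (nabla (e l) (e k) p) =
      (\<Sum>m\<in>UNIV. \<epsilon> m * connection_coeff e i j m p * connection_coeff e l k m p)"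
    unfolding connection_coeff_def
    by (rule orthonormal_metric_expansion[OF frame_orthonormal_at[OF e U(2)] nT nT])
  moreover have "nabla (nabla (e l) (e i)) (e j) p =
      (\<Sum>m\<in>UNIV. (\<epsilon> m * connection_coeff e l i m p) *\<^sub>R nabla (e m) (e j) p)"
    unfolding connection_coeff_def
    by (rule tensorial_at_expansion[OF tensorial_nabla[OF U e'] U e nn])
  then have "g p (nabla (nabla (e l) (e i)) (e j) p) (e k p) =
      (\<Sum>m\<in>UNIV. \<epsilon> m * connection_coeff e l i m p * connection_coeff e m j k p)"
    by (simp only: metric_sum_left[OF eT nT]) (simp only: connection_coeff_def)
  moreover have "g p (second_covariant (e l) (e i) (e j) p) (e k p) =
      g p (nabla (e l) (nabla (e i) (e j)) p) (e k p) - g p (nabla (nabla (e l) (e i)) (e j) p) (e k p)"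
    unfolding second_covariant_def
    by (intro metric_diff_left eT nabla_tangent[OF U] e' nn)
  ultimately show ?thesis by linarith
qed

end

section \<open>Algebra of the structure tensors\<close>

context paracontact_metric_manifold
begin

lemma xi_tangent: "\<xi> p \<in> tangent_space A p"
  using smooth_vfield_onD(1)[OF xi_vfield] by simp

lemma phi_tangent: "v \<in> tangent_space A p \<Longrightarrow> \<phi> p v \<in> tangent_space A p"
  using phi_tensor unfolding endomorphism_field_def by (simp add: image_subset_iff)

lemma
  shows phi_scale: "v \<in> tangent_space A p \<Longrightarrow> \<phi> p (r *\<^sub>R v) = r *\<^sub>R \<phi> p v"
    and eta_scale: "v \<in> tangent_space A p \<Longrightarrow> \<eta> p (r *\<^sub>R v) = r * \<eta> p v"
    and eta_add: "u \<in> tangent_space A p \<Longrightarrow> v \<in> tangent_space A p \<Longrightarrow> \<eta> p (u + v) = \<eta> p u + \<eta> p v"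
  using phi_tensor eta_form unfolding endomorphism_field_def one_form_def linear_on_def by simp_all

lemma xi_nonzero: "\<xi> p \<noteq> 0"
proof
  assume "\<xi> p = 0"
  then have "\<eta> p (\<xi> p) = 0" using eta_scale[OF xi_tangent, of p 0] by simp
  then show False using eta_xi[of p] by simp
qed

text \<open>From \<open>phi_square\<close>, \<phi>^2 \<xi> = 0. The same identity at \<phi> \<xi>
  then gives \<phi> \<xi> = c \<xi>, and applying \<phi> once more gives c^2 \<xi> = 0.\<close>

lemma phi_xi: "\<phi> p (\<xi> p) = 0"
proof -
  define c where "c = \<eta> p (\<phi> p (\<xi> p))"
  note T = xi_tangent[of p] phi_tangent[OF xi_tangent[of p]]
  have sq: "\<phi> p (\<phi> p (\<xi> p)) = 0"
    using phi_square[OF T(1)] eta_xi[of p] by simp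
  have "\<phi> p (\<phi> p (\<phi> p (\<xi> p))) = 0"
    unfolding sq using phi_scale[OF T(1), of 0] by simp
  then have c: "\<phi> p (\<xi> p) = c *\<^sub>R \<xi> p"
    using phi_square[OF T(2)] by (simp add: c_def)
  have "\<phi> p (\<phi> p (\<xi> p)) = (c * c) *\<^sub>R \<xi> p"
    using phi_scale[OF T(1), of c] unfolding c by simp
  then have "c = 0" using sq xi_nonzero[of p] by simp
  then show ?thesis using c by simp
qed

text \<open>Computing \<phi>^3 v in two ways, as \<phi> of \<phi>^2 v and as \<phi>^2 of \<phi> v,
  leaves \<eta>(\<phi> v) \<xi> = 0.\<close>

lemma eta_phi:
  assumes v: "v \<in> tangent_space A p"
  shows "\<eta> p (\<phi> p v) = 0"
proof -
  note T = phi_tangent[OF v]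
  have "linear_on (tangent_space A p) (\<phi> p)"
    using phi_tensor unfolding endomorphism_field_def by simp
  from linear_on_sum[OF subspace_tangent_space this, of "{True, False}"
      "\<lambda>b. if b then v else \<xi> p" "\<lambda>b. if b then 1 else - \<eta> p v"]
  have "\<phi> p (v - \<eta> p v *\<^sub>R \<xi> p) = \<phi> p v"
    using v xi_tangent[of p] by (simp add: phi_xi)
  then have "\<phi> p v = \<phi> p v - \<eta> p (\<phi> p v) *\<^sub>R \<xi> p"
    using phi_square[OF v] phi_square[OF T] by simp
  then show ?thesis using xi_nonzero[of p] by simp
qed

text \<open>This is the compatibility of the metric with \<phi> for the second argument \<xi>, where
  \<phi> \<xi> = 0.\<close>

lemma metric_xi:
  assumes u: "u \<in> tangent_space A p"
  shows "g p u (\<xi> p) = \<eta> p u"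
proof -
  have "g p (\<phi> p u) 0 = 0"
    using metric_scale_right[OF phi_tangent[OF u] xi_tangent xi_tangent, of 0] by simp
  then show ?thesis
    using metric_phi[OF u xi_tangent] eta_xi[of p] by (simp add: phi_xi)
qed

end

section \<open>Adapted frames\<close>

context paracontact_metric_manifold
begin

text \<open>Evaluating g(\<phi> v, \<phi>^2 v) through \<open>phi_square\<close> and through
  \<open>metric_phi\<close> gives opposite signs for g(v, \<phi> v).\<close>

lemma metric_phi_self:
  assumes v: "v \<in> tangent_space A p"
  shows "g p v (\<phi> p v) = 0"
proof -
  note T = phi_tangent[OF v]
  have "g p (\<phi> p v) (\<phi> p (\<phi> p v)) = g p (\<phi> p v) v - \<eta> p v * g p (\<phi> p v) (\<xi> p)"
    using phi_square[OF v]
      metric_diff_right[OF T v subspace_scale[OF subspace_tangent_space xi_tangent]]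
      metric_scale_right[OF T xi_tangent xi_tangent] by simp
  then show ?thesis
    using metric_phi[OF v T] metric_sym[OF v T] eta_phi[OF v] by (simp add: metric_xi[OF T])
qed

text \<open>A vanishing eigenspace would force dimension 1, so there is a horizontal
  \<open>u \<noteq> 0\<close>. Nondegeneracy pairs it with some horizontal \<open>w\<close>. On
  horizontal vectors \<phi> reverses the sign of g(v, v), so one that is not null is enough.\<close>

lemma horizontal_spacelike_vector:
  assumes "CARD('d) > 1"
  obtains v where "v \<in> tangent_space A p" "\<eta> p v = 0" "g p v v > 0"
proof -
  let ?T = "tangent_space A p"
  let ?S = "{v \<in> ?T. \<eta> p v = 0 \<and> \<phi> p v = v}"
  have "\<exists>u\<in>?S. u \<noteq> 0"
  proof (rule ccontr)
    assume "\<not> (\<exists>u\<in>?S. u \<noteq> 0)"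
    then have "?S \<subseteq> {0}" by auto
    then have "span ?S = span {}"
      using span_mono[of ?S "{0}"] span_mono[of "{}" ?S] by auto
    then have "dim ?S = 0"
      using real_vector.dim_eq_card[of "{}" ?S] real_vector.independent_empty by simp
    then show False using dim_plus[of p] assms by simp
  qed
  then obtain u where u: "u \<in> ?T" "\<eta> p u = 0" "u \<noteq> 0" by auto
  obtain z where z: "z \<in> ?T" "g p u z \<noteq> 0"
    using metric_nondegenerate[OF u(1)] u(3) by auto
  define w where "w = z + (- \<eta> p z) *\<^sub>R \<xi> p"
  have sT: "(- \<eta> p z) *\<^sub>R \<xi> p \<in> ?T" by (rule subspace_scale[OF subspace_tangent_space xi_tangent])
  have w: "w \<in> ?T" unfolding w_def by (rule subspace_add[OF subspace_tangent_space z(1) sT])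
  have \<eta>w: "\<eta> p w = 0"
    unfolding w_def by (simp add: eta_add[OF z(1) sT] eta_scale[OF xi_tangent] eta_xi del: scaleR_minus_left)
  have gw: "g p u w \<noteq> 0"
    unfolding w_def using z(2) u
    by (simp add: metric_add_right[OF u(1) z(1) sT] metric_scale_right[OF u(1) xi_tangent xi_tangent]
        metric_xi[OF u(1)] del: scaleR_minus_left)
  have uw: "u + w \<in> ?T" by (rule subspace_add[OF subspace_tangent_space u(1) w])
  have "g p (u + w) (u + w) = g p u u + 2 * g p u w + g p w w"
    by (simp add: metric_add_right[OF uw u(1) w] metric_add_left[OF u(1) u(1) w]
        metric_add_left[OF w u(1) w] metric_sym[OF w u(1)])
  moreover have "\<eta> p (u + w) = 0" using eta_add[OF u(1) w] u(2) \<eta>w by simp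
  \<comment> \<open>Polarization: \<open>u\<close>, \<open>w\<close> and \<open>u + w\<close> cannot
    all be null, since g(u, w) is nonzero.\<close>
  ultimately obtain v where v: "v \<in> ?T" "\<eta> p v = 0" "g p v v \<noteq> 0"
    using gw u(1,2) w \<eta>w uw that by (metis add_0 add_0_right mult_eq_0_iff zero_neq_numeral)
  show ?thesis
  proof (cases "g p v v > 0")
    case True
    then show ?thesis using v that by simp
  next
    case False
    then have "g p (\<phi> p v) (\<phi> p v) > 0" using metric_phi[OF v(1) v(1)] v by simp
    then show ?thesis using that[OF phi_tangent[OF v(1)] eta_phi[OF v(1)]] by simp
  qed
qed

lemma horizontal_unit_field:
  assumes "CARD('d) > 1"
  obtains U X where "open U" "p \<in> U" "smooth_vfield_on A U X"
    "\<And>q. q \<in> U \<Longrightarrow> \<eta> q (X q) = 0" "\<And>q. q \<in> U \<Longrightarrow> g q (X q) (X q) = 1"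
proof -
  obtain v where v: "v \<in> tangent_space A p" "\<eta> p v = 0" "g p v v > 0"
    using horizontal_spacelike_vector[OF assms] .
  obtain W V where W: "open W" "p \<in> W" and V: "smooth_vfield_on A W V" "V p = v"
    using tangent_vector_extension[OF v(1)] .
  \<comment> \<open>The horizontal projection along \<xi>. It keeps the value \<open>v\<close> at
    \<open>p\<close>, which is already horizontal.\<close>
  define Y where "Y = (\<lambda>q. V q + (- 1 * \<eta> q (V q)) *\<^sub>R \<xi> q)"
  have \<xi>W: "smooth_vfield_on A W \<xi>" by (rule smooth_vfield_on_subset[OF xi_vfield]) simp
  have "smooth_fun_on A W (\<lambda>q. \<eta> q (V q))"
    using eta_form W(1) V(1) unfolding one_form_def by simp
  then have Y: "smooth_vfield_on A W Y"
    unfolding Y_def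
    by (intro smooth_vfield_on_add smooth_vfield_on_scale smooth_fun_on_mult smooth_fun_on_const W V \<xi>W)
  have \<eta>Y: "\<eta> q (Y q) = 0" if q: "q \<in> W" for q
    using eta_add[OF smooth_vfield_onD(1)[OF V(1) q] subspace_scale[OF subspace_tangent_space xi_tangent],
        of "- 1 * \<eta> q (V q)"] eta_scale[OF xi_tangent, of q "- 1 * \<eta> q (V q)"] eta_xi[of q]
    unfolding Y_def by (simp only:)
  have Yp: "Y p = v" unfolding Y_def V(2) v(2) by simp
  let ?f = "\<lambda>q. g q (Y q) (Y q)"
  have f: "smooth_fun_on A W ?f" by (rule metric_smooth[OF W(1) Y Y])
  \<comment> \<open>Positivity at \<open>p\<close> persists nearby by continuity, and where it holds
    the power -1/2 is smooth.\<close>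
  define U where "U = W \<inter> ?f -` {0<..}"
  have U: "open U" "p \<in> U" "U \<subseteq> W"
    using continuous_open_preimage[OF smooth_fun_on_imp_continuous_on[OF W(1) f] W(1) open_greaterThan]
      W(2) v(3) Yp unfolding U_def by auto
  have pos: "?f q > 0" if "q \<in> U" for q using that unfolding U_def by auto
  let ?X = "\<lambda>q. (?f q powr (- 1 / 2)) *\<^sub>R Y q"
  have YT: "Y q \<in> tangent_space A q" if "q \<in> U" for q
    using U(3) that by (intro smooth_vfield_onD(1)[OF Y]) auto
  have "smooth_vfield_on A U ?X"
    by (intro smooth_vfield_on_scale smooth_fun_on_powr pos smooth_fun_on_subset[OF f U(3)]
        smooth_vfield_on_subset[OF Y U(3)] U(1))
  moreover have "\<eta> q (?X q) = 0" if "q \<in> U" for q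
    using eta_scale[OF YT[OF that]] \<eta>Y U(3) that by auto
  moreover have "g q (?X q) (?X q) = 1" if q: "q \<in> U" for q
  proof -
    note T = YT[OF q] subspace_scale[OF subspace_tangent_space YT[OF q]]
    have "g q (?X q) (?X q) = (?f q powr (- 1 / 2) * ?f q powr (- 1 / 2)) * ?f q"
      by (simp add: metric_scale_right[OF T(2) T(1) T(1)] metric_scale_left[OF T(1) T(1) T(1)])
    also have "\<dots> = 1"
      using pos[OF q] by (simp add: powr_add[symmetric] powr_minus_divide)
    finally show ?thesis .
  qed
  ultimately show ?thesis using that[OF U(1,2), of ?X] by simp
qed

end

text \<open>For a horizontal unit field X, the field \<phi> X is horizontal, orthogonal to X and of
  square -1. Taking it as \<open>e 3\<close> gives \<phi> e_3 = \<phi>^2 X = X = e_2.\<close>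

lemma adapted_frame_exists:
  fixes A :: "('m::{t2_space, second_countable_topology}, 3) chart set"
  assumes "paracontact_metric_manifold A \<phi> \<xi> \<eta> g"
  obtains U e where "open U" "p \<in> U"
    "pseudo_orthonormal_frame_on A g U e (\<lambda>i. if i = 3 then - 1 else 1)"
    "e 1 = \<xi>" "\<And>q. q \<in> U \<Longrightarrow> \<phi> q (e 3 q) = e 2 q"
proof -
  interpret paracontact_metric_manifold A \<phi> \<xi> \<eta> g by fact
  obtain U X where U: "open U" "p \<in> U" and X: "smooth_vfield_on A U X"
    and \<eta>X: "\<And>q. q \<in> U \<Longrightarrow> \<eta> q (X q) = 0" and gX: "\<And>q. q \<in> U \<Longrightarrow> g q (X q) (X q) = 1"
    using horizontal_unit_field[of p] by auto
  define e :: "3 \<Rightarrow> 'm vfield" where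
    "e i = (if i = 1 then \<xi> else if i = 2 then X else (\<lambda>q. \<phi> q (X q)))" for i
  \<comment> \<open>Arithmetic in the type \<open>3\<close> is modulo 3, so the numeral 3 denotes
    its element 0.\<close>
  have distinct: "(1::3) \<noteq> 2" "(1::3) \<noteq> 3" "(2::3) \<noteq> 3" by simp_all
  have e: "e 1 = \<xi>" "e 2 = X" "e 3 = (\<lambda>q. \<phi> q (X q))"
    using distinct by (simp_all add: e_def)
  have sm: "smooth_vfield_on A U (e i)" for i
    using exhaust_3[of i] e X smooth_vfield_on_subset[OF xi_vfield, of U] phi_tensor U(1)
    unfolding endomorphism_field_def by auto
  have gram: "g q (e i q) (e j q) = (if i = j then if i = 3 then - 1 else 1 else 0)" if q: "q \<in> U" for q i j
  proof -
    have XT: "X q \<in> tangent_space A q" by (rule smooth_vfield_onD(1)[OF X q])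
    note T = xi_tangent[of q] XT phi_tangent[OF XT]
    have "g q (\<xi> q) (\<xi> q) = 1" "g q (X q) (\<xi> q) = 0" "g q (\<phi> q (X q)) (\<xi> q) = 0"
      "g q (X q) (\<phi> q (X q)) = 0" "g q (\<phi> q (X q)) (\<phi> q (X q)) = - 1"
      using metric_xi[OF T(1)] metric_xi[OF T(2)] metric_xi[OF T(3)] eta_xi \<eta>X[OF q] eta_phi[OF XT]
        metric_phi_self[OF XT] metric_phi[OF XT XT] gX[OF q] by simp_all
    then show ?thesis
      using exhaust_3[of i] exhaust_3[of j] distinct gX[OF q]
        metric_sym[OF T(2,1)] metric_sym[OF T(3,1)] metric_sym[OF T(3,2)]
      by (elim disjE) (simp_all add: e)
  qed
  show ?thesis
  proof (rule that[of U e, OF U _ e(1)])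
    show "pseudo_orthonormal_frame_on A g U e (\<lambda>i. if i = 3 then - 1 else 1)"
      using sm gram unfolding pseudo_orthonormal_frame_on_def by simp
    show "\<phi> q (e 3 q) = e 2 q" if "q \<in> U" for q
      using phi_square[OF smooth_vfield_onD(1)[OF X that]] \<eta>X[OF that] by (simp add: e)
  qed
qed

section \<open>Structure equations of an adapted frame\<close>

locale adapted_frame = paracontact_metric_manifold A \<phi> \<xi> \<eta> g + levi_civita_connection A g nabla
  for A :: "('m::{t2_space, second_countable_topology}, 3) chart set"
    and \<phi> \<xi> \<eta> g nabla +
  fixes U :: "'m set" and e :: "3 \<Rightarrow> 'm vfield"
  assumes domain: "open U"
    and frame: "pseudo_orthonormal_frame_on A g U e (\<lambda>i. if i = 3 then - 1 else 1)"
    and e1: "e 1 = \<xi>"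
    and phi_e3: "q \<in> U \<Longrightarrow> \<phi> q (e 3 q) = e 2 q"
begin

abbreviation \<omega> :: "3 \<Rightarrow> 3 \<Rightarrow> 3 \<Rightarrow> 'm \<Rightarrow> real"
  where "\<omega> i j k q \<equiv> connection_coeff e i j k q"

lemmas e_smooth = frame_smooth[OF frame]
lemmas \<omega>_smooth = connection_coeff_smooth[OF domain frame]
lemmas \<omega>_skew = connection_coeff_skew[OF domain _ frame]

lemma e_tangent: "q \<in> U \<Longrightarrow> e i q \<in> tangent_space A q"
  by (rule smooth_vfield_onD(1)[OF e_smooth])

lemma gram: "q \<in> U \<Longrightarrow> g q (e i q) (e j q) = (if i = j then if i = 3 then - 1 else 1 else 0)"
  using frame unfolding pseudo_orthonormal_frame_on_def by simp

text \<open>Each \<eta>(e_j) is constant, so 2 d\<eta>(e_i, e_j) reduces to -\<eta>([e_i, e_j]).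
  Torsion-freeness and \<open>metric_xi\<close> turn the latter into connection
  coefficients.\<close>

lemma \<omega>_structure:
  assumes q: "q \<in> U"
  shows "\<omega> i j 1 q - \<omega> j i 1 q = - 2 * g q (e i q) (\<phi> q (e j q))"
proof -
  have \<eta>: "\<eta> q (e j q) = (if j = 1 then 1 else 0)" if "q \<in> U" for j q
    using metric_xi[OF e_tangent[OF that, of j]] gram[OF that, of j 1] e1 by auto
  have d: "e i q (\<lambda>q. \<eta> q (e j q)) = 0" for i j
    by (rule tangent_vector_const[OF e_tangent[OF q] domain q \<eta>])
  have "\<eta> q (lie_bracket A (e i) (e j) q) = g q (nabla (e i) (e j) q - nabla (e j) (e i) q) (\<xi> q)"
    unfolding nabla_torsion_free[OF domain e_smooth e_smooth q]
    by (rule metric_xi[symmetric, OF smooth_vfield_onD(1)[OF lie_bracket_smooth[OF domain e_smooth e_smooth] q]])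
  also have "\<dots> = \<omega> i j 1 q - \<omega> j i 1 q"
    unfolding connection_coeff_def e1
    by (intro metric_diff_left nabla_tangent[OF domain q] e_smooth xi_tangent)
  finally show ?thesis
    using deta[OF domain e_smooth e_smooth q, of i j] unfolding ext_deriv_def d by simp
qed

text \<open>The integral curves of \<xi> are geodesics, because d\<eta>(\<xi>, e_k) = \<eta>(\<phi>
  e_k) = 0.\<close>

lemma \<omega>_geodesic:
  assumes q: "q \<in> U"
  shows "\<omega> 1 1 k q = 0"
proof -
  have "g q (e 1 q) (\<phi> q (e k q)) = 0"
    using metric_xi[OF phi_tangent[OF e_tangent[OF q]]] eta_phi[OF e_tangent[OF q]]
      metric_sym[OF xi_tangent phi_tangent[OF e_tangent[OF q]]] by (simp add: e1)
  then show ?thesis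
    using \<omega>_structure[OF q, of 1 k] \<omega>_skew[OF q, of 1 1 k] \<omega>_skew[OF q, of k 1 1] by simp
qed

text \<open>The constant is the 2 of the convention for d\<eta> times g(e_2, \<phi> e_3) = g(e_2,
  e_2) = 1.\<close>

lemma \<omega>_twist: "q \<in> U \<Longrightarrow> \<omega> 2 1 3 q = \<omega> 3 1 2 q + 2"
  using \<omega>_structure[of q 2 3] \<omega>_skew[of q 2 1 3] \<omega>_skew[of q 3 1 2] gram[of q 2 2]
  by (simp add: phi_e3)

text \<open>Rewrite rules to a normal form. Six functions remain: \<open>\<omega> i 2 3\<close> for
  the three values of \<open>i\<close>, and \<open>\<omega> 2 1 2\<close>,
  \<open>\<omega> 3 1 2\<close>, \<open>\<omega> 3 1 3\<close>.\<close>

lemma \<omega>_reduce: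
  assumes q: "q \<in> U"
  shows "\<omega> i j j q = 0" "\<omega> i 2 1 q = - \<omega> i 1 2 q" "\<omega> i 3 1 q = - \<omega> i 1 3 q"
    "\<omega> i 3 2 q = - \<omega> i 2 3 q" "\<omega> 1 1 2 q = 0" "\<omega> 1 1 3 q = 0" "\<omega> 2 1 3 q = \<omega> 3 1 2 q + 2"
  using \<omega>_skew[OF q, of i j j] \<omega>_skew[OF q, of i 2 1] \<omega>_skew[OF q, of i 3 1] \<omega>_skew[OF q, of i 3 2]
    \<omega>_geodesic[OF q] \<omega>_twist[OF q] by simp_all

lemma \<omega>_deriv_skew:
  assumes q: "q \<in> U"
  shows "e l q (\<omega> i j k) = - e l q (\<omega> i k j)"
proof -
  have "e l q (\<omega> i j k) + e l q (\<omega> i k j) = 0"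
    by (rule tangent_vector_sum_const[OF e_tangent[OF q] domain q \<omega>_smooth \<omega>_smooth, where r = 0])
      (use \<omega>_skew[of _ i j k] in simp)
  then show ?thesis by simp
qed

text \<open>The same normal form for directional derivatives, where the constant of
  \<open>\<omega>_twist\<close> drops out.\<close>

lemma \<omega>_deriv_reduce:
  assumes q: "q \<in> U"
  shows "e l q (\<omega> i j j) = 0" "e l q (\<omega> i 2 1) = - e l q (\<omega> i 1 2)"
    "e l q (\<omega> i 3 1) = - e l q (\<omega> i 1 3)" "e l q (\<omega> i 3 2) = - e l q (\<omega> i 2 3)"
    "e l q (\<omega> 1 1 2) = 0" "e l q (\<omega> 1 1 3) = 0" "e l q (\<omega> 2 1 3) = e l q (\<omega> 3 1 2)"
proof -
  show "e l q (\<omega> i j j) = 0" using \<omega>_deriv_skew[OF q, of l i j j] by simp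
  show "e l q (\<omega> i 2 1) = - e l q (\<omega> i 1 2)"
    "e l q (\<omega> i 3 1) = - e l q (\<omega> i 1 3)" "e l q (\<omega> i 3 2) = - e l q (\<omega> i 2 3)"
    by (rule \<omega>_deriv_skew[OF q])+
  have "e l q (\<omega> 1 1 k) = 0" for k
    by (rule tangent_vector_const[OF e_tangent[OF q] domain q, where r = 0]) (rule \<omega>_geodesic)
  then show "e l q (\<omega> 1 1 2) = 0" "e l q (\<omega> 1 1 3) = 0" by this+
  show "e l q (\<omega> 2 1 3) = e l q (\<omega> 3 1 2)"
    by (rule tangent_vector_diff_const[OF e_tangent[OF q] domain q \<omega>_smooth \<omega>_twist])
qed

lemma second_covariant_frame:
  assumes q: "q \<in> U"
  shows "g q (second_covariant (e l) (e i) (e j) q) (e k q) = e l q (\<omega> i j k)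
    - (\<omega> i j 1 q * \<omega> l k 1 q + \<omega> i j 2 q * \<omega> l k 2 q - \<omega> i j 3 q * \<omega> l k 3 q)
    - (\<omega> l i 1 q * \<omega> 1 j k q + \<omega> l i 2 q * \<omega> 2 j k q - \<omega> l i 3 q * \<omega> 3 j k q)"
  by (simp add: second_covariant_coeff[OF domain q frame] sum_3)

lemma bianchi_frame:
  assumes q: "q \<in> U"
  defines "s \<equiv> \<lambda>l i j k. g q (second_covariant (e l) (e i) (e j) q) (e k q)"
  shows "s 1 2 3 l - s 1 3 2 l + (s 2 3 1 l - s 2 1 3 l) + (s 3 1 2 l - s 3 2 1 l) = 0"
proof -
  have T: "second_covariant (e i) (e j) (e k) q \<in> tangent_space A q" for i j k
    by (rule second_covariant_tangent[OF domain q e_smooth e_smooth e_smooth])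
  note S = subspace_diff[OF subspace_tangent_space T T]
  note E = e_tangent[OF q, of l]
  have "g q 0 (e l q) = 0" using metric_scale_left[OF E E E, of 0] by simp
  then show ?thesis
    unfolding s_def second_covariant_bianchi[OF domain q e_smooth[of 1] e_smooth[of 2] e_smooth[of 3], symmetric]
    by (simp add: metric_add_left[OF E subspace_add[OF subspace_tangent_space S S] S]
        metric_add_left[OF E S S] metric_diff_left[OF E T T])
qed

text \<open>This is div \<xi> = 0. In the \<xi>-component of the Jacobi identity, \<eta>([e_2, e_3])
  = -2 is constant and the other two brackets are horizontal. What remains is this nonzero constant
  times the difference of the two sides.\<close>

lemma \<omega>_trace:
  assumes q: "q \<in> U"
  shows "\<omega> 2 1 2 q = \<omega> 3 1 3 q"
  using bianchi_frame[OF q, of 1]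
  by (simp add: second_covariant_frame[OF q] \<omega>_reduce[OF q] \<omega>_deriv_reduce[OF q] algebra_simps)

lemma \<omega>_trace_deriv: "q \<in> U \<Longrightarrow> e l q (\<omega> 2 1 2) = e l q (\<omega> 3 1 3)"
  using tangent_vector_cong[OF e_tangent domain _ \<omega>_trace] .

lemma ricci_frame:
  assumes q: "q \<in> U"
  defines "s \<equiv> \<lambda>l i j k. g q (second_covariant (e l) (e i) (e j) q) (e k q)"
  shows "ricci_tensor A nabla q (e j q) (e k q) =
    (s 1 j k 1 - s j 1 k 1) + (s 2 j k 2 - s j 2 k 2) - (s 3 j k 3 - s j 3 k 3)"
proof -
  have "g q (curvature_at A nabla q (e i q) (e j q) (e k q)) (e i q) = s i j k i - s j i k i" for i
    unfolding curvature_at_eq[OF domain q frame e_smooth e_smooth e_smooth]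
      curvature_eq_second_covariant[OF domain q e_smooth e_smooth e_smooth] s_def
    by (intro metric_diff_left e_tangent q second_covariant_tangent[OF domain q] e_smooth)
  then show ?thesis
    by (simp add: ricci_tensor_frame[OF domain q frame e_tangent[OF q] e_tangent[OF q]] sum_3)
qed

lemma rough_laplacian_adapted:
  assumes q: "q \<in> U"
  defines "s \<equiv> \<lambda>l i j k. g q (second_covariant (e l) (e i) (e j) q) (e k q)"
  shows "rough_laplacian A g nabla \<xi> q \<in> tangent_space A q"
    and "g q (rough_laplacian A g nabla \<xi> q) (e k q) = s 1 1 1 k + s 2 2 1 k - s 3 3 1 k"
proof -
  have T: "second_covariant (e i) (e j) (e k) q \<in> tangent_space A q" for i j k
    by (rule second_covariant_tangent[OF domain q e_smooth e_smooth e_smooth])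
  note L = rough_laplacian_frame[OF domain q frame e_smooth[of 1]]
  show "rough_laplacian A g nabla \<xi> q \<in> tangent_space A q"
    unfolding e1[symmetric] L by (intro tangent_sum T)
  show "g q (rough_laplacian A g nabla \<xi> q) (e k q) = s 1 1 1 k + s 2 2 1 k - s 3 3 1 k"
    unfolding e1[symmetric] L s_def
    by (subst metric_sum_left[OF e_tangent[OF q] T]) (simp add: sum_3)
qed

text \<open>Once \<xi> is geodesic and divergence free with constant twist, both sides have the same
  normal form. The index 1 is left out because collinearity with \<xi> does not involve that
  component.\<close>

lemma rough_laplacian_eq_ricci:
  assumes q: "q \<in> U" and k: "k \<noteq> 1"
  shows "g q (rough_laplacian A g nabla \<xi> q) (e k q) = g q (ricci_operator A g nabla q (\<xi> q)) (e k q)"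
proof -
  have R: "g q (ricci_operator A g nabla q (\<xi> q)) (e k q) = ricci_tensor A nabla q (e 1 q) (e k q)"
    using ricci_operator_characterization[OF domain q frame xi_tangent] e_tangent[OF q]
    by (simp add: e1)
  note S = second_covariant_frame[OF q] \<omega>_reduce[OF q] \<omega>_deriv_reduce[OF q] \<omega>_trace[OF q] \<omega>_trace_deriv[OF q]
  consider "k = 2" | "k = 3" using exhaust_3[of k] k by auto
  then show ?thesis
  proof cases
    case 1
    show ?thesis
      \<comment> \<open>Of Ric(\<xi>, e_2) only the term with g(R(e_3, \<xi>) e_2, e_3) survives.
        This component of the Bianchi identity turns it into g(R(e_2, e_3) \<xi>, e_3), which
        contains second derivatives of \<xi> only. It amounts to Ric(\<xi>, e_2) = Ric(e_2,
        \<xi>).\<close>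
      using bianchi_frame[OF q, of 3]
      unfolding R unfolding 1
      by (simp add: rough_laplacian_adapted[OF q] ricci_frame[OF q] S algebra_simps)
  next
    case 2
    show ?thesis
      \<comment> \<open>Now the surviving term is g(R(e_2, \<xi>) e_3, e_2), so the component along
        \<open>e 2\<close> provides the symmetry of Ric.\<close>
      using bianchi_frame[OF q, of 2]
      unfolding R unfolding 2
      by (simp add: rough_laplacian_adapted[OF q] ricci_frame[OF q] S algebra_simps)
  qed
qed

lemma collinear_xi_iff:
  assumes q: "q \<in> U" and u: "u \<in> tangent_space A q"
  shows "(\<exists>c. u = c *\<^sub>R \<xi> q) \<longleftrightarrow> g q u (e 2 q) = 0 \<and> g q u (e 3 q) = 0"
proof
  assume "\<exists>c. u = c *\<^sub>R \<xi> q"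
  then obtain c where "u = c *\<^sub>R e 1 q" unfolding e1 by blast
  then show "g q u (e 2 q) = 0 \<and> g q u (e 3 q) = 0"
    using metric_scale_left[OF e_tangent[OF q] e_tangent[OF q, of 1] e_tangent[OF q]] gram[OF q]
    by simp
next
  assume "g q u (e 2 q) = 0 \<and> g q u (e 3 q) = 0"
  then show "\<exists>c. u = c *\<^sub>R \<xi> q"
    using frame_expansion[OF frame q u] by (auto simp: sum_3 e1)
qed

lemma rough_laplacian_collinear_iff:
  assumes q: "q \<in> U"
  shows "(\<exists>c. rough_laplacian A g nabla \<xi> q = c *\<^sub>R \<xi> q) \<longleftrightarrow>
    (\<exists>c. ricci_operator A g nabla q (\<xi> q) = c *\<^sub>R \<xi> q)"
proof -
  have "ricci_operator A g nabla q (\<xi> q) \<in> tangent_space A q"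
    using ricci_operator_characterization[OF domain q frame xi_tangent] by simp
  then show ?thesis
    using rough_laplacian_eq_ricci[OF q, of 2] rough_laplacian_eq_ricci[OF q, of 3]
    by (simp add: collinear_xi_iff[OF q] rough_laplacian_adapted(1)[OF q])
qed

end

theorem theorem1p1:
  fixes A :: "('m::{t2_space, second_countable_topology}, 3) chart set"
    and \<phi> :: "'m \<Rightarrow> 'm tvec \<Rightarrow> 'm tvec"
    and \<xi> :: "'m vfield"
    and \<eta> :: "'m \<Rightarrow> 'm tvec \<Rightarrow> real"
    and g :: "'m \<Rightarrow> 'm tvec \<Rightarrow> 'm tvec \<Rightarrow> real"
    and nabla :: "'m vfield \<Rightarrow> 'm vfield \<Rightarrow> 'm vfield"
  assumes "paracontact_metric_manifold A \<phi> \<xi> \<eta> g"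
    and "levi_civita_connection A g nabla"
  shows "harmonic_vector_field A g nabla \<xi> \<longleftrightarrow>
           (\<forall>p. \<exists>c. ricci_operator A g nabla p (\<xi> p) = c *\<^sub>R \<xi> p)"
proof -
  interpret P: paracontact_metric_manifold A \<phi> \<xi> \<eta> g by fact
  \<comment> \<open>Smoothness and constant nonzero length hold for \<xi> itself. What remains is
    collinearity at each point, which an adapted frame around that point decides.\<close>
  have "g p (\<xi> p) (\<xi> p) = 1" for p
    using P.metric_xi[OF P.xi_tangent] P.eta_xi by simp
  then have "\<exists>c. c \<noteq> 0 \<and> (\<forall>p. g p (\<xi> p) (\<xi> p) = c)"
    by (intro exI[of _ 1]) simp
  moreover have "(\<exists>c. rough_laplacian A g nabla \<xi> p = c *\<^sub>R \<xi> p) \<longleftrightarrow>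
      (\<exists>c. ricci_operator A g nabla p (\<xi> p) = c *\<^sub>R \<xi> p)" for p
  proof -
    obtain U e where U: "open U" "p \<in> U"
      and e: "pseudo_orthonormal_frame_on A g U e (\<lambda>i. if i = 3 then - 1 else 1)" "e 1 = \<xi>"
        "\<And>q. q \<in> U \<Longrightarrow> \<phi> q (e 3 q) = e 2 q"
      by (rule adapted_frame_exists[OF assms(1), of p]) (rule that)
    interpret adapted_frame A \<phi> \<xi> \<eta> g nabla U e
      by (intro adapted_frame.intro adapted_frame_axioms.intro assms U(1) e)
    show ?thesis by (rule rough_laplacian_collinear_iff[OF U(2)])
  qed
  ultimately show ?thesis
    using P.xi_vfield unfolding harmonic_vector_field_def by simp
qed

end
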